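(* Let $H$ be a Hilbert $C^*$-module and $Q\in\mathcal{L}(H)$ an idempotent. Then $$s(Q)=m(Q)+(I-Q^* )|Q^*|^\dagger+|Q^*|^\dagger(I-Q).$$
   Context: $H$ is a Hilbert module over a $C^*$-algebra, $\mathcal{L}(H)$ the adjointable operators. For $T\in\mathcal{L}(H)$, $|T|=(T^*T)^{1/2}$, and $T^\dagger$ is the Moore–Penrose inverse (unique $X$ with $TXT=T$, $XTX=X$, $(TX)^*=TX$, $(XT)^*=XT$; exists iff $\mathcal{R}(T)$ closed). For an idempotent $Q$, the matched projection is $m(Q)=\tfrac12(|Q^*|+Q^* )|Q^*|^\dagger(|Q^*|+I)^{-1}(|Q^*|+Q)$, and the supplementary projection is $s(Q)=m(2P_{\mathcal{R}(Q)}-Q)$, where $P_{\mathcal{R}(Q)}$ is the projection onto $\mathcal{R}(Q)$. *)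

theory Defs
  imports "HOL-Analysis.Analysis"
begin

class complex_vs = real_vector +
  fixes cscale :: "complex \<Rightarrow> 'a \<Rightarrow> 'a"
  assumes cscale_of_real: "cscale (complex_of_real r) x = scaleR r x"
    and cscale_add_right: "cscale c (x + y) = cscale c x + cscale c y"
    and cscale_add_left: "cscale (c + d) x = cscale c x + cscale d x"
    and cscale_cscale: "cscale c (cscale d x) = cscale (c * d) x"

class cstar_algebra = complex_vs + real_normed_algebra + banach +
  fixes cstar :: "'a \<Rightarrow> 'a"
  assumes cscale_mult_left: "cscale c (x * y) = cscale c x * y"
    and cscale_mult_right: "cscale c (x * y) = x * cscale c y"
    and norm_cscale: "norm (cscale c x) = cmod c * norm x"
    and cstar_cstar: "cstar (cstar x) = x"
    and cstar_add: "cstar (x + y) = cstar x + cstar y"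
    and cstar_cscale: "cstar (cscale c x) = cscale (cnj c) (cstar x)"
    and cstar_mult: "cstar (x * y) = cstar y * cstar x"
    and cstar_identity: "norm (cstar x * x) = (norm x)\<^sup>2"

definition cpos :: "'a::cstar_algebra \<Rightarrow> bool" where
  "cpos a \<longleftrightarrow> (\<exists>b. a = cstar b * b)"

definition hmod_norm :: "('m \<Rightarrow> 'm \<Rightarrow> 'a::cstar_algebra) \<Rightarrow> 'm \<Rightarrow> real" where
  "hmod_norm ip x = sqrt (norm (ip x x))"

definition hilbert_cstar_module ::
  "('m::complex_vs \<Rightarrow> 'm \<Rightarrow> 'a::cstar_algebra) \<Rightarrow> ('m \<Rightarrow> 'a \<Rightarrow> 'm) \<Rightarrow> bool" where
  "hilbert_cstar_module ip act \<longleftrightarrow>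
     (\<forall>x a b. act x (a * b) = act (act x a) b) \<and>
     (\<forall>x a b. act x (a + b) = act x a + act x b) \<and>
     (\<forall>x y a. act (x + y) a = act x a + act y a) \<and>
     (\<forall>c x a. cscale c (act x a) = act (cscale c x) a) \<and>
     (\<forall>c x a. cscale c (act x a) = act x (cscale c a)) \<and>
     (\<forall>x y z. ip x (y + z) = ip x y + ip x z) \<and>
     (\<forall>c x y. ip x (cscale c y) = cscale c (ip x y)) \<and>
     (\<forall>x y a. ip x (act y a) = ip x y * a) \<and>
     (\<forall>x y. ip y x = cstar (ip x y)) \<and>
     (\<forall>x. cpos (ip x x)) \<and>
     (\<forall>x. ip x x = 0 \<longrightarrow> x = 0) \<and>
     (\<forall>f :: nat \<Rightarrow> 'm.
        (\<forall>e>0. \<exists>N. \<forall>m\<ge>N. \<forall>n\<ge>N. hmod_norm ip (f m - f n) < e) \<longrightarrow>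
        (\<exists>x. (\<lambda>n. hmod_norm ip (f n - x)) \<longlonglongrightarrow> 0))"

definition adjointable :: "('m \<Rightarrow> 'm \<Rightarrow> 'a) \<Rightarrow> ('m \<Rightarrow> 'm) \<Rightarrow> bool" where
  "adjointable ip T \<longleftrightarrow> (\<exists>S. \<forall>x y. ip (T x) y = ip x (S y))"

definition adj :: "('m \<Rightarrow> 'm \<Rightarrow> 'a) \<Rightarrow> ('m \<Rightarrow> 'm) \<Rightarrow> ('m \<Rightarrow> 'm)" where
  "adj ip T = (THE S. \<forall>x y. ip (T x) y = ip x (S y))"

definition op_add :: "('m::real_vector \<Rightarrow> 'm) \<Rightarrow> ('m \<Rightarrow> 'm) \<Rightarrow> ('m \<Rightarrow> 'm)" where
  "op_add S T = (\<lambda>x. S x + T x)"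

definition op_diff :: "('m::real_vector \<Rightarrow> 'm) \<Rightarrow> ('m \<Rightarrow> 'm) \<Rightarrow> ('m \<Rightarrow> 'm)" where
  "op_diff S T = (\<lambda>x. S x - T x)"

definition op_scale :: "real \<Rightarrow> ('m::real_vector \<Rightarrow> 'm) \<Rightarrow> ('m \<Rightarrow> 'm)" where
  "op_scale r T = (\<lambda>x. r *\<^sub>R T x)"

definition op_pos :: "('m \<Rightarrow> 'm \<Rightarrow> 'a) \<Rightarrow> ('m \<Rightarrow> 'm) \<Rightarrow> bool" where
  "op_pos ip T \<longleftrightarrow> (\<exists>R. adjointable ip R \<and> T = adj ip R \<circ> R)"

definition op_abs :: "('m \<Rightarrow> 'm \<Rightarrow> 'a) \<Rightarrow> ('m \<Rightarrow> 'm) \<Rightarrow> ('m \<Rightarrow> 'm)" where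
  "op_abs ip T = (THE S. op_pos ip S \<and> S \<circ> S = adj ip T \<circ> T)"

definition mp_inv :: "('m \<Rightarrow> 'm \<Rightarrow> 'a) \<Rightarrow> ('m \<Rightarrow> 'm) \<Rightarrow> ('m \<Rightarrow> 'm)" where
  "mp_inv ip T = (THE X. adjointable ip X \<and> T \<circ> X \<circ> T = T \<and> X \<circ> T \<circ> X = X \<and>
       adj ip (T \<circ> X) = T \<circ> X \<and> adj ip (X \<circ> T) = X \<circ> T)"

definition op_inv :: "('m \<Rightarrow> 'm \<Rightarrow> 'a) \<Rightarrow> ('m \<Rightarrow> 'm) \<Rightarrow> ('m \<Rightarrow> 'm)" where
  "op_inv ip T = (THE X. adjointable ip X \<and> X \<circ> T = id \<and> T \<circ> X = id)"

definition range_proj :: "('m \<Rightarrow> 'm \<Rightarrow> 'a) \<Rightarrow> ('m \<Rightarrow> 'm) \<Rightarrow> ('m \<Rightarrow> 'm)" where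
  "range_proj ip T = (THE P. adjointable ip P \<and> P \<circ> P = P \<and> adj ip P = P \<and>
       range P = range T)"

definition matched_proj :: "('m::real_vector \<Rightarrow> 'm \<Rightarrow> 'a) \<Rightarrow> ('m \<Rightarrow> 'm) \<Rightarrow> ('m \<Rightarrow> 'm)" where
  "matched_proj ip Q =
     (let A = op_abs ip (adj ip Q) in
      op_scale (1/2) (op_add A (adj ip Q) \<circ> mp_inv ip A \<circ> op_inv ip (op_add A id)
                        \<circ> op_add A Q))"

definition supp_proj :: "('m::real_vector \<Rightarrow> 'm \<Rightarrow> 'a) \<Rightarrow> ('m \<Rightarrow> 'm) \<Rightarrow> ('m \<Rightarrow> 'm)" where
  "supp_proj ip Q = matched_proj ip (op_diff (op_scale 2 (range_proj ip Q)) Q)"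

end

theory Submission
  imports Defs
begin

text \<open>
  Let \<open>P\<close> be the projection onto the range of \<open>Q\<close> and \<open>N = Q - P\<close>.  Then \<open>P N = N\<close> and \<open>N P = 0\<close>, so
  \<open>Q Q\<^sup>* = P + N N\<^sup>*\<close>; replacing \<open>Q = P + N\<close> by \<open>2P - Q = P - N\<close> does not change \<open>S = |Q\<^sup>*|\<close>.  With
  \<open>G = S\<^sup>\<dagger> (S + I)\<^sup>-\<^sup>1\<close> one has \<open>G (S + P) = (S + P) G = S\<^sup>\<dagger>\<close>, hence
  \<open>m(Q) = (P + S\<^sup>\<dagger> + S\<^sup>\<dagger> N + N\<^sup>* S\<^sup>\<dagger> + N\<^sup>* G N) / 2\<close> and \<open>s(Q) - m(Q) = - N\<^sup>* S\<^sup>\<dagger> - S\<^sup>\<dagger> N\<close>, which is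
  the claim because \<open>S\<^sup>\<dagger>\<close> absorbs \<open>P\<close> on both sides.

  That \<open>S\<close>, \<open>S\<^sup>\<dagger>\<close>, \<open>(S + I)\<^sup>-\<^sup>1\<close> and \<open>P\<close> exist uniquely rests on the order structure of the C*-algebra of
  adjointable operators.  It is obtained without spectral theory: positive elements are squares of
  self-adjoint ones, recognised by \<open>\<parallel>t - a\<parallel> \<le> t\<close>, and square roots come from an iteration.
\<close>

section \<open>Positive elements of unital C*-algebras\<close>

lemma le_if_square_le_mult:
  fixes a b :: real
  assumes "a\<^sup>2 \<le> b * a" "0 \<le> b"
  shows "a \<le> b"
proof (cases "0 < a")
  case True
  then show ?thesis using assms(1) by (simp add: power2_eq_square)
qed (use assms(2) in simp)

text \<open>The iteration \<open>y \<mapsto> (x + y\<^sup>2) / 2\<close> converges to \<open>1 - \<surd>(1 - x)\<close>; its increments are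
  dominated by those of the scalar iteration with \<open>x = 1\<close>, which increases to \<open>1\<close>.\<close>

fun sqrt_iter :: "'c::real_algebra \<Rightarrow> nat \<Rightarrow> 'c" where
  "sqrt_iter x 0 = 0"
| "sqrt_iter x (Suc n) = (1/2) *\<^sub>R (x + sqrt_iter x n * sqrt_iter x n)"

lemma sqrt_iter_commute:
  assumes "z * x = x * z"
  shows "z * sqrt_iter x n = sqrt_iter x n * z"
proof (induction n)
  case (Suc n)
  then have "z * (sqrt_iter x n * sqrt_iter x n) = sqrt_iter x n * sqrt_iter x n * z"
    by (metis mult.assoc)
  then show ?case using assms by (simp add: algebra_simps)
qed simp

lemma sqrt_iter_increment:
  "sqrt_iter x (Suc (Suc n)) - sqrt_iter x (Suc n)
    = (1/2) *\<^sub>R ((sqrt_iter x (Suc n) - sqrt_iter x n) * (sqrt_iter x (Suc n) + sqrt_iter x n))"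
proof -
  have "sqrt_iter x (Suc n) * sqrt_iter x n = sqrt_iter x n * sqrt_iter x (Suc n)"
    by (rule sqrt_iter_commute[OF sqrt_iter_commute[OF refl, symmetric]])
  then have "(sqrt_iter x (Suc n) - sqrt_iter x n) * (sqrt_iter x (Suc n) + sqrt_iter x n)
      = sqrt_iter x (Suc n) * sqrt_iter x (Suc n) - sqrt_iter x n * sqrt_iter x n"
    by (simp add: ring_distribs del: sqrt_iter.simps)
  then show ?thesis
    unfolding sqrt_iter.simps(2)[of x "Suc n"]
    by (subst (3) sqrt_iter.simps(2)) (simp add: scaleR_add_right scaleR_diff_right)
qed

lemma sqrt_iter_one_bounds: "0 \<le> sqrt_iter (1::real) n \<and> sqrt_iter (1::real) n \<le> 1"
proof (induction n)
  case (Suc n)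
  then have "sqrt_iter (1::real) n * sqrt_iter 1 n \<le> 1" by (simp add: mult_le_one)
  then show ?case using Suc by simp
qed simp

lemma sqrt_iter_one_mono: "sqrt_iter (1::real) n \<le> sqrt_iter 1 (Suc n)"
proof -
  have "0 \<le> (1 - sqrt_iter (1::real) n)\<^sup>2" by simp
  then show ?thesis by (simp add: power2_eq_square algebra_simps)
qed

lemma convergent_sqrt_iter_one: "convergent (sqrt_iter (1::real))"
proof (rule Bseq_mono_convergent)
  show "Bseq (sqrt_iter (1::real))"
    using sqrt_iter_one_bounds by (intro BseqI'[where K = 1]) simp
  show "\<forall>m n. m \<le> n \<longrightarrow> sqrt_iter (1::real) m \<le> sqrt_iter 1 n"
    using lift_Suc_mono_le[of "sqrt_iter (1::real)"] sqrt_iter_one_mono by blast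
qed

text \<open>A carrier set is needed because the adjointable operators depend on the inner product; the type
  class omits \<open>0 \<noteq> 1\<close> so that the zero module is covered.  The central element \<open>imag\<close> plays the role
  of the imaginary unit.\<close>

locale unital_cstar =
  fixes B :: "'b::{real_algebra, monoid_mult} set"
    and st :: "'b \<Rightarrow> 'b"
    and nrm :: "'b \<Rightarrow> real"
    and imag :: 'b
  assumes one_closed [simp, intro]: "1 \<in> B"
    and add_closed [simp, intro]: "\<lbrakk>x \<in> B; y \<in> B\<rbrakk> \<Longrightarrow> x + y \<in> B"
    and mult_closed [simp, intro]: "\<lbrakk>x \<in> B; y \<in> B\<rbrakk> \<Longrightarrow> x * y \<in> B"
    and scaleR_closed [simp, intro]: "x \<in> B \<Longrightarrow> r *\<^sub>R x \<in> B"
    and st_closed [simp, intro]: "x \<in> B \<Longrightarrow> st x \<in> B"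
    and st_st [simp]: "x \<in> B \<Longrightarrow> st (st x) = x"
    and st_add [simp]: "\<lbrakk>x \<in> B; y \<in> B\<rbrakk> \<Longrightarrow> st (x + y) = st x + st y"
    and st_mult [simp]: "\<lbrakk>x \<in> B; y \<in> B\<rbrakk> \<Longrightarrow> st (x * y) = st y * st x"
    and st_scaleR [simp]: "x \<in> B \<Longrightarrow> st (r *\<^sub>R x) = r *\<^sub>R st x"
    and nrm_eq_0: "\<lbrakk>x \<in> B; nrm x = 0\<rbrakk> \<Longrightarrow> x = 0"
    and nrm_add: "\<lbrakk>x \<in> B; y \<in> B\<rbrakk> \<Longrightarrow> nrm (x + y) \<le> nrm x + nrm y"
    and nrm_scaleR: "x \<in> B \<Longrightarrow> nrm (r *\<^sub>R x) = \<bar>r\<bar> * nrm x"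
    and nrm_mult: "\<lbrakk>x \<in> B; y \<in> B\<rbrakk> \<Longrightarrow> nrm (x * y) \<le> nrm x * nrm y"
    and nrm_square_le: "x \<in> B \<Longrightarrow> (nrm x)\<^sup>2 \<le> nrm (st x * x)"
    and complete: "\<lbrakk>\<And>n::nat. f n \<in> B;
          \<forall>e>0. \<exists>M. \<forall>m\<ge>M. \<forall>n\<ge>M. nrm (f m - f n) < e\<rbrakk>
        \<Longrightarrow> \<exists>x\<in>B. (\<lambda>n. nrm (f n - x)) \<longlonglongrightarrow> 0"
    and imag_closed [simp, intro]: "imag \<in> B"
    and imag_central: "x \<in> B \<Longrightarrow> x * imag = imag * x"
    and imag_imag: "imag * imag = - 1"
    and st_imag [simp]: "st imag = - imag"
begin

lemma zero_closed [simp, intro]: "0 \<in> B"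
  using scaleR_closed[OF one_closed, of 0] by simp

lemma minus_closed [simp, intro]: "x \<in> B \<Longrightarrow> - x \<in> B"
  using scaleR_closed[of x "-1"] by simp

lemma diff_closed [simp, intro]: "\<lbrakk>x \<in> B; y \<in> B\<rbrakk> \<Longrightarrow> x - y \<in> B"
  using add_closed[of x "- y"] by simp

lemma st_zero [simp]: "st 0 = 0"
  using st_scaleR[OF one_closed, of 0] by simp

lemma st_minus [simp]: "x \<in> B \<Longrightarrow> st (- x) = - st x"
  using st_scaleR[of x "-1"] by simp

lemma st_diff [simp]: "\<lbrakk>x \<in> B; y \<in> B\<rbrakk> \<Longrightarrow> st (x - y) = st x - st y"
  using st_add[of x "- y"] by simp

lemma st_one [simp]: "st 1 = 1"
proof -
  have "st 1 = st 1 * st (st 1)" by simp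
  also have "\<dots> = st (st 1 * 1)" by (subst st_mult) auto
  finally show ?thesis by simp
qed

lemma nrm_zero [simp]: "nrm 0 = 0"
  using nrm_scaleR[OF one_closed, of 0] by simp

lemma nrm_minus [simp]: "x \<in> B \<Longrightarrow> nrm (- x) = nrm x"
  using nrm_scaleR[of x "-1"] by simp

lemma nrm_diff: "\<lbrakk>x \<in> B; y \<in> B\<rbrakk> \<Longrightarrow> nrm (x - y) \<le> nrm x + nrm y"
  using nrm_add[of x "- y"] by simp

lemma nrm_diff_commute: "\<lbrakk>x \<in> B; y \<in> B\<rbrakk> \<Longrightarrow> nrm (x - y) = nrm (y - x)"
  using nrm_minus[of "x - y"] by simp

lemma nrm_nonneg [simp]: "x \<in> B \<Longrightarrow> 0 \<le> nrm x"
  using nrm_diff[of x x] by simp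

lemma nrm_pos: "\<lbrakk>x \<in> B; x \<noteq> 0\<rbrakk> \<Longrightarrow> 0 < nrm x"
  using nrm_eq_0[of x] nrm_nonneg[of x] by linarith

lemma nrm_one: "nrm 1 \<le> 1"
  by (rule le_if_square_le_mult) (use nrm_square_le[OF one_closed] in simp_all)

lemma nrm_st [simp]: assumes "x \<in> B" shows "nrm (st x) = nrm x"
proof -
  have nrm_le: "nrm y \<le> nrm (st y)" if y: "y \<in> B" for y
    by (rule le_if_square_le_mult) (use nrm_square_le[OF y] nrm_mult[of "st y" y] y in simp_all)
  show ?thesis using nrm_le[of x] nrm_le[of "st x"] assms by simp
qed

lemma nrm_st_mult: "x \<in> B \<Longrightarrow> nrm (st x * x) = (nrm x)\<^sup>2"
  using nrm_square_le[of x] nrm_mult[of "st x" x] by (simp add: power2_eq_square)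

lemma nrm_square: "\<lbrakk>x \<in> B; st x = x\<rbrakk> \<Longrightarrow> nrm (x * x) = (nrm x)\<^sup>2"
  using nrm_st_mult[of x] by simp

lemma square_eq_0: "\<lbrakk>x \<in> B; st x = x; x * x = 0\<rbrakk> \<Longrightarrow> x = 0"
  using nrm_square[of x] nrm_eq_0[of x] by simp

lemma cube_eq_0: assumes "x \<in> B" "st x = x" "x * x * x = 0" shows "x = 0"
proof -
  have "(x * x) * (x * x) = 0" using assms by (metis mult.assoc mult_zero_left)
  then have "x * x = 0" using square_eq_0[of "x * x"] assms by simp
  then show ?thesis using square_eq_0 assms by blast
qed

subsection \<open>Limits\<close>

definition conv :: "(nat \<Rightarrow> 'b) \<Rightarrow> 'b \<Rightarrow> bool" where
  "conv f x \<longleftrightarrow> (\<forall>n. f n \<in> B) \<and> x \<in> B \<and> (\<lambda>n. nrm (f n - x)) \<longlonglongrightarrow> 0"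

lemma conv_closed: "conv f x \<Longrightarrow> f n \<in> B" "conv f x \<Longrightarrow> x \<in> B"
  by (simp_all add: conv_def)

lemma conv_if_bounded:
  assumes "\<And>n. f n \<in> B" "x \<in> B" "\<And>n. nrm (f n - x) \<le> d n" "d \<longlonglongrightarrow> 0"
  shows "conv f x"
proof -
  have "(\<lambda>n. nrm (f n - x)) \<longlonglongrightarrow> 0"
    by (rule Lim_null_comparison[OF _ assms(4)]) (use assms in simp)
  then show ?thesis using assms by (simp add: conv_def)
qed

lemma conv_unique:
  assumes "conv f x" "conv f y"
  shows "x = y"
proof -
  have "(\<lambda>n. nrm (f n - x) + nrm (f n - y)) \<longlonglongrightarrow> 0"
    using assms by (auto simp: conv_def intro: tendsto_add_zero)
  moreover have "nrm (y - x) \<le> nrm (f n - x) + nrm (f n - y)" for n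
    using nrm_diff[of "f n - x" "f n - y"] assms by (simp add: conv_def)
  ultimately have "nrm (y - x) \<le> 0" by (intro LIMSEQ_le_const) auto
  then show ?thesis using nrm_pos[of "y - x"] conv_closed(2) assms by fastforce
qed

lemma conv_const: "x \<in> B \<Longrightarrow> conv (\<lambda>n. x) x"
  by (simp add: conv_def)

lemma conv_Suc: "conv f x \<Longrightarrow> conv (\<lambda>n. f (Suc n)) x"
  by (auto simp: conv_def intro: LIMSEQ_Suc)

lemma conv_add:
  assumes "conv f x" "conv g y"
  shows "conv (\<lambda>n. f n + g n) (x + y)"
proof (rule conv_if_bounded)
  show "nrm (f n + g n - (x + y)) \<le> nrm (f n - x) + nrm (g n - y)" for n
    using nrm_add[of "f n - x" "g n - y"] assms by (simp add: conv_def algebra_simps)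
  show "(\<lambda>n. nrm (f n - x) + nrm (g n - y)) \<longlonglongrightarrow> 0"
    using assms by (auto simp: conv_def intro: tendsto_add_zero)
qed (use assms in \<open>auto simp: conv_def\<close>)

lemma conv_scaleR: "conv f x \<Longrightarrow> conv (\<lambda>n. r *\<^sub>R f n) (r *\<^sub>R x)"
  by (auto simp: conv_def nrm_scaleR tendsto_mult_right_zero simp flip: scaleR_diff_right)

lemma conv_st: "conv f x \<Longrightarrow> conv (\<lambda>n. st (f n)) (st x)"
  by (auto simp: conv_def simp flip: st_diff)

lemma conv_nrm:
  assumes "conv f x"
  shows "(\<lambda>n. nrm (f n)) \<longlonglongrightarrow> nrm x"
proof -
  have reverse_triangle: "\<bar>nrm (f n) - nrm x\<bar> \<le> nrm (f n - x)" for n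
  proof -
    have "f n \<in> B" "x \<in> B" using assms by (auto simp: conv_def)
    then show ?thesis
      using nrm_add[of "f n - x" x] nrm_add[of "x - f n" "f n"] nrm_diff_commute[of x "f n"] by simp
  qed
  have "(\<lambda>n. nrm (f n - x)) \<longlonglongrightarrow> 0" using assms by (simp add: conv_def)
  then have "(\<lambda>n. nrm (f n) - nrm x) \<longlonglongrightarrow> 0"
    by (rule Lim_null_comparison[rotated]) (use reverse_triangle in simp)
  then show ?thesis by (simp add: LIM_zero_iff)
qed

lemma conv_mult:
  assumes "conv f x" "conv g y"
  shows "conv (\<lambda>n. f n * g n) (x * y)"
proof (rule conv_if_bounded)
  fix n
  have "f n * g n - x * y = (f n - x) * g n + x * (g n - y)" by (simp add: algebra_simps)
  also have "nrm \<dots> \<le> nrm ((f n - x) * g n) + nrm (x * (g n - y))"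
    using assms by (intro nrm_add) (auto simp: conv_def)
  also have "\<dots> \<le> nrm (f n - x) * nrm (g n) + nrm x * nrm (g n - y)"
    using assms by (intro add_mono nrm_mult) (auto simp: conv_def)
  finally show "nrm (f n * g n - x * y) \<le> nrm (f n - x) * nrm (g n) + nrm x * nrm (g n - y)" .
next
  have "(\<lambda>n. nrm (f n - x) * nrm (g n)) \<longlonglongrightarrow> 0 * nrm y"
    using assms(1) conv_nrm[OF assms(2)] unfolding conv_def by (intro tendsto_mult) auto
  moreover have "(\<lambda>n. nrm x * nrm (g n - y)) \<longlonglongrightarrow> 0"
    using assms(2) by (auto simp: conv_def intro: tendsto_mult_right_zero)
  ultimately show "(\<lambda>n. nrm (f n - x) * nrm (g n) + nrm x * nrm (g n - y)) \<longlonglongrightarrow> 0"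
    using tendsto_add_zero by simp
qed (use assms in \<open>auto simp: conv_def\<close>)

lemma commute_limit:
  assumes "conv f x" "z \<in> B" "\<And>n. z * f n = f n * z"
  shows "z * x = x * z"
proof (rule conv_unique)
  show "conv (\<lambda>n. f n * z) (x * z)" using assms conv_mult conv_const by blast
  show "conv (\<lambda>n. f n * z) (z * x)" using conv_mult[OF conv_const[OF assms(2)] assms(1)] assms(3) by simp
qed

lemma conv_if_dominated_increments:
  assumes closed: "\<And>n. f n \<in> B" and convergent_s: "convergent s"
    and increment: "\<And>n. nrm (f (Suc n) - f n) \<le> s (Suc n) - s n"
  obtains x where "conv f x"
proof -
  have forward: "nrm (f (n + k) - f n) \<le> s (n + k) - s n" for n k
  proof (induction k)
    case (Suc k)
    have "f (n + Suc k) - f n = (f (Suc (n + k)) - f (n + k)) + (f (n + k) - f n)" by simp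
    also have "nrm \<dots> \<le> nrm (f (Suc (n + k)) - f (n + k)) + nrm (f (n + k) - f n)"
      using closed by (intro nrm_add) auto
    finally show ?case using Suc increment[of "n + k"] by simp
  qed simp
  have diff: "nrm (f m - f n) \<le> \<bar>s m - s n\<bar>" for m n
  proof (cases "n \<le> m")
    case True
    then show ?thesis using forward[of n "m - n"] by simp
  next
    case False
    then show ?thesis using forward[of m "n - m"] nrm_diff_commute[of "f m" "f n"] closed by simp
  qed
  have "\<forall>e>0. \<exists>M. \<forall>m\<ge>M. \<forall>n\<ge>M. nrm (f m - f n) < e"
    using convergent_s diff unfolding Cauchy_convergent_iff[symmetric] Cauchy_def dist_real_def
    by (meson le_less_trans)
  then show thesis using complete closed that unfolding conv_def by blast
qed

subsection \<open>Square roots\<close>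

definition bicommutant :: "'b \<Rightarrow> 'b set" where
  "bicommutant a = {y \<in> B. \<forall>z\<in>B. z * a = a * z \<longrightarrow> z * y = y * z}"

lemma bicommutant_closed: "y \<in> bicommutant a \<Longrightarrow> y \<in> B"
  by (simp add: bicommutant_def)

lemma bicommutant_commute: "\<lbrakk>y \<in> bicommutant a; z \<in> B; z * a = a * z\<rbrakk> \<Longrightarrow> z * y = y * z"
  by (auto simp: bicommutant_def)

lemma sqrt_iter_closed: "x \<in> B \<Longrightarrow> sqrt_iter x n \<in> B"
  by (induction n) auto

lemma st_sqrt_iter: "\<lbrakk>x \<in> B; st x = x\<rbrakk> \<Longrightarrow> st (sqrt_iter x n) = sqrt_iter x n"
  by (induction n) (auto simp: sqrt_iter_closed)

lemma nrm_sqrt_iter: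
  assumes "x \<in> B" "nrm x \<le> 1"
  shows "nrm (sqrt_iter x n) \<le> sqrt_iter 1 n"
proof (induction n)
  case (Suc n)
  let ?y = "sqrt_iter x n"
  have y_closed: "?y \<in> B" using assms(1) by (rule sqrt_iter_closed)
  have "nrm (x + ?y * ?y) \<le> nrm x + nrm ?y * nrm ?y"
    using nrm_add[of x "?y * ?y"] nrm_mult[of ?y ?y] assms(1) y_closed by simp
  also have "\<dots> \<le> 1 + sqrt_iter 1 n * sqrt_iter 1 n"
    using nrm_nonneg[OF y_closed] Suc by (intro add_mono mult_mono assms(2)) linarith+
  finally show ?case using assms(1) y_closed by (simp add: nrm_scaleR)
qed simp

lemma nrm_sqrt_iter_increment:
  assumes x: "x \<in> B" "nrm x \<le> 1"
  shows "nrm (sqrt_iter x (Suc n) - sqrt_iter x n) \<le> sqrt_iter 1 (Suc n) - sqrt_iter 1 n"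
proof (induction n)
  case 0
  then show ?case using x by (simp add: nrm_scaleR)
next
  case (Suc n)
  let ?d = "sqrt_iter x (Suc n) - sqrt_iter x n" and ?s = "sqrt_iter x (Suc n) + sqrt_iter x n"
  have closed: "?d \<in> B" "?s \<in> B" by (intro add_closed diff_closed sqrt_iter_closed x)+
  have "nrm ?s \<le> nrm (sqrt_iter x (Suc n)) + nrm (sqrt_iter x n)"
    by (intro nrm_add sqrt_iter_closed x)
  also have "\<dots> \<le> sqrt_iter 1 (Suc n) + sqrt_iter 1 n" by (intro add_mono nrm_sqrt_iter x)
  finally have "nrm ?d * nrm ?s
      \<le> (sqrt_iter 1 (Suc n) - sqrt_iter 1 n) * (sqrt_iter 1 (Suc n) + sqrt_iter 1 n)"
    using Suc closed sqrt_iter_one_mono[of n] by (intro mult_mono) (auto simp del: sqrt_iter.simps)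
  then have "nrm (?d * ?s)
      \<le> (sqrt_iter 1 (Suc n) - sqrt_iter 1 n) * (sqrt_iter 1 (Suc n) + sqrt_iter 1 n)"
    using nrm_mult[OF closed] by linarith
  then show ?case
    unfolding sqrt_iter_increment using closed by (simp add: nrm_scaleR del: sqrt_iter.simps)
qed

lemma sqrt_one_minus:
  assumes x: "x \<in> B" "st x = x" "nrm x \<le> 1"
  obtains y where "st y = y" "nrm y \<le> 1" "(1 - y) * (1 - y) = 1 - x" "y \<in> bicommutant x"
proof -
  obtain y where lim: "conv (sqrt_iter x) y"
    using conv_if_dominated_increments[OF sqrt_iter_closed[OF x(1)] convergent_sqrt_iter_one
        nrm_sqrt_iter_increment[OF x(1,3)]] by blast
  have "conv (sqrt_iter x) (st y)" using conv_st[OF lim] x by (simp add: st_sqrt_iter)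
  then have "st y = y" using lim conv_unique by blast
  moreover have "nrm (sqrt_iter x n) \<le> 1" for n
    using nrm_sqrt_iter[OF x(1,3), of n] sqrt_iter_one_bounds[of n] by linarith
  then have "nrm y \<le> 1" using LIMSEQ_le_const2[OF conv_nrm[OF lim]] by blast
  moreover have "(1 - y) * (1 - y) = 1 - x"
  proof -
    have "conv (\<lambda>n. sqrt_iter x (Suc n)) ((1/2) *\<^sub>R (x + y * y))"
      unfolding sqrt_iter.simps by (intro conv_scaleR conv_add conv_mult conv_const lim x)
    then have "y = (1/2) *\<^sub>R (x + y * y)" by (rule conv_unique[OF conv_Suc[OF lim]])
    then have "2 *\<^sub>R y = 2 *\<^sub>R (1/2) *\<^sub>R (x + y * y)" by (rule arg_cong)
    then show ?thesis by (simp add: algebra_simps scaleR_2)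
  qed
  moreover have "y \<in> bicommutant x"
    using commute_limit[OF lim _ sqrt_iter_commute] conv_closed(2)[OF lim] by (simp add: bicommutant_def)
  ultimately show thesis by (rule that)
qed

definition pos :: "'b \<Rightarrow> bool" where
  "pos a \<longleftrightarrow> (\<exists>h\<in>B. st h = h \<and> a = h * h)"

lemma posE:
  assumes "pos a" obtains h where "h \<in> B" "st h = h" "a = h * h"
  using assms by (auto simp: pos_def)

lemma pos_square: "\<lbrakk>h \<in> B; st h = h\<rbrakk> \<Longrightarrow> pos (h * h)"
  by (auto simp: pos_def)

lemma pos_closed [simp]: "pos a \<Longrightarrow> a \<in> B"
  and pos_sa [simp]: "pos a \<Longrightarrow> st a = a"
  by (auto simp: pos_def)

lemma pos_one: "pos 1"
  using pos_square[of 1] by simp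

lemma pos_scaleR: assumes "pos a" "0 \<le> r" shows "pos (r *\<^sub>R a)"
proof -
  obtain h where h: "h \<in> B" "st h = h" "a = h * h" using assms(1) by (rule posE)
  have "r *\<^sub>R a = (sqrt r *\<^sub>R h) * (sqrt r *\<^sub>R h)" using h assms by simp
  moreover have "pos ((sqrt r *\<^sub>R h) * (sqrt r *\<^sub>R h))" by (rule pos_square) (use h in simp_all)
  ultimately show ?thesis by simp
qed

lemma sqrt_near_scalar:
  assumes a: "a \<in> B" "st a = a" and t: "0 < t" "nrm (t *\<^sub>R 1 - a) \<le> t"
  obtains r where "pos r" "r * r = a" "r \<in> bicommutant a"
proof -
  define x where "x = 1 - (1/t) *\<^sub>R a"
  have "x = (1/t) *\<^sub>R (t *\<^sub>R 1 - a)" using t by (simp add: x_def algebra_simps)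
  then have "nrm x \<le> 1" using a t by (simp add: nrm_scaleR)
  then obtain y where y: "st y = y" "nrm y \<le> 1" "(1 - y) * (1 - y) = 1 - x" "y \<in> bicommutant x"
    using sqrt_one_minus[of x] a by (auto simp: x_def)
  obtain w where w: "st w = w" "(1 - w) * (1 - w) = 1 - y" "w \<in> B"
    using sqrt_one_minus[of y] y(1,2,4) bicommutant_closed by metis
  show thesis
  proof
    have "pos (1 - y)" using pos_square[of "1 - w"] w by simp
    then show "pos (sqrt t *\<^sub>R (1 - y))" using t by (simp add: pos_scaleR)
    show "(sqrt t *\<^sub>R (1 - y)) * (sqrt t *\<^sub>R (1 - y)) = a" using t y(3) by (simp add: x_def)
    show "sqrt t *\<^sub>R (1 - y) \<in> bicommutant a"
      using y(4) by (auto simp: bicommutant_def x_def algebra_simps)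
  qed
qed

lemma pos_near_scalar:
  assumes "a \<in> B" "st a = a" "0 < t" "nrm (t *\<^sub>R 1 - a) \<le> t"
  shows "pos a"
proof -
  obtain r where "pos r" "r * r = a" using sqrt_near_scalar[OF assms] by blast
  then show ?thesis using pos_square[of r] by simp
qed

lemma pos_scalar_minus:
  assumes "a \<in> B" "st a = a" "0 < t" "nrm a \<le> t"
  shows "pos (t *\<^sub>R 1 - a)"
  using assms by (intro pos_near_scalar[of _ t]) auto

text \<open>The element \<open>a + i w\<close> is \<open>\<surd>t\<close> times a unitary, and \<open>a\<close> is its real part.\<close>

lemma nrm_square_le_if_sum_squares_scalar:
  assumes a: "a \<in> B" "st a = a" and w: "w \<in> B" "st w = w"
    and commute: "a * w = w * a" and sum: "a * a + w * w = t *\<^sub>R 1" and t_nonneg: "0 \<le> t"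
  shows "nrm (a * a) \<le> t"
proof -
  define u where "u = a + imag * w"
  have u_closed: "u \<in> B" using a w by (simp add: u_def)
  have st_u: "st u = a - imag * w" using a w imag_central[of w] by (simp add: u_def)
  have "imag * w * (imag * w) = imag * imag * (w * w)"
    using imag_central[of w] w by (metis mult.assoc)
  then have square_iw: "imag * w * (imag * w) = - (w * w)" using imag_imag by simp
  have a_iw: "a * (imag * w) = imag * w * a"
    using imag_central[of a] a commute by (metis mult.assoc)
  have "st u * u = t *\<^sub>R 1"
    unfolding st_u sum[symmetric] using square_iw a_iw by (simp add: u_def algebra_simps)
  then have "(nrm u)\<^sup>2 = t * nrm 1" using nrm_st_mult[OF u_closed] t_nonneg by (simp add: nrm_scaleR)
  also have "\<dots> \<le> t" using mult_left_mono[OF nrm_one t_nonneg] by simp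
  finally have nrm_u: "(nrm u)\<^sup>2 \<le> t" .
  have "a = (1/2) *\<^sub>R (u + st u)" unfolding st_u by (simp add: u_def flip: scaleR_2)
  then have "nrm a = (1/2) * nrm (u + st u)" using u_closed by (simp add: nrm_scaleR)
  then have "nrm a \<le> nrm u" using nrm_add[of u "st u"] u_closed by simp
  then have "(nrm a)\<^sup>2 \<le> (nrm u)\<^sup>2" using a by (intro power_mono) auto
  then show ?thesis using nrm_u a by (simp add: nrm_square)
qed

lemma nrm_le_if_complementary_squares:
  assumes h: "h \<in> B" "st h = h" and t: "0 \<le> t"
    and r: "pos r" "r * r = t *\<^sub>R 1 - h * h" "r \<in> bicommutant (t *\<^sub>R 1 - h * h)"
  shows "nrm (h * h) \<le> t" "nrm (r * r) \<le> t"
proof -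
  have commute: "h * r = r * h"
    using bicommutant_commute[OF r(3) h(1)] by (simp add: algebra_simps)
  show "nrm (h * h) \<le> t"
    using nrm_square_le_if_sum_squares_scalar[of h r t] r(1,2) h t commute by simp
  show "nrm (r * r) \<le> t"
    using nrm_square_le_if_sum_squares_scalar[of r h t] r(1,2) h t commute by simp
qed

lemma pos_nrm_scalar_minus:
  assumes "pos a" "nrm a \<le> t" shows "nrm (t *\<^sub>R 1 - a) \<le> t"
proof (cases "t = 0")
  case True
  then show ?thesis using assms by simp
next
  case False
  then have t_pos: "0 < t" using nrm_nonneg[OF pos_closed[OF assms(1)]] assms(2) by linarith
  obtain h where h: "h \<in> B" "st h = h" "a = h * h" using assms(1) by (rule posE)
  obtain r where r: "pos r" "r * r = t *\<^sub>R 1 - a" "r \<in> bicommutant (t *\<^sub>R 1 - a)"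
    using sqrt_near_scalar[of "t *\<^sub>R 1 - a" t] assms t_pos by auto
  have "nrm (r * r) \<le> t"
    using nrm_le_if_complementary_squares[OF h(1,2)] r t_pos h(3) by simp
  then show ?thesis using r(2) by simp
qed

lemma pos_sqrt:
  assumes "pos a"
  obtains r where "pos r" "r * r = a" "r \<in> bicommutant a"
proof (rule sqrt_near_scalar[of a "nrm a + 1"])
  show "0 < nrm a + 1" using assms by (simp add: add_nonneg_pos)
  show "nrm ((nrm a + 1) *\<^sub>R 1 - a) \<le> nrm a + 1" using assms by (simp add: pos_nrm_scalar_minus)
qed (use assms in auto)

lemma pos_add: assumes "pos a" "pos b" shows "pos (a + b)"
proof (rule pos_near_scalar)
  define s where "s = nrm a + 1"
  define t where "t = nrm b + 1"
  show "0 < s + t"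
    using assms[THEN pos_closed, THEN nrm_nonneg] by (simp add: s_def t_def)
  have "(s + t) *\<^sub>R 1 - (a + b) = (s *\<^sub>R 1 - a) + (t *\<^sub>R 1 - b)"
    by (simp add: algebra_simps)
  also have "nrm \<dots> \<le> nrm (s *\<^sub>R 1 - a) + nrm (t *\<^sub>R 1 - b)"
    using assms by (intro nrm_add) auto
  also have "\<dots> \<le> s + t"
    using assms by (intro add_mono pos_nrm_scalar_minus) (auto simp: s_def t_def)
  finally show "nrm ((s + t) *\<^sub>R 1 - (a + b)) \<le> s + t" .
qed (use assms in auto)

lemma pos_mult_if_commute:
  assumes "pos a" "pos b" "a * b = b * a"
  shows "pos (a * b)"
proof -
  obtain h where h: "pos h" "h * h = a" "h \<in> bicommutant a" using pos_sqrt assms(1) by blast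
  obtain k where k: "pos k" "k * k = b" "k \<in> bicommutant b" using pos_sqrt assms(2) by blast
  have "b * h = h * b" using bicommutant_commute[OF h(3), of b] assms by simp
  then have h_k_commute: "h * k = k * h" using bicommutant_commute[OF k(3), of h] h(1) by simp
  then have "a * b = (h * k) * (h * k)" using h(2) k(2) by (metis mult.assoc)
  then show ?thesis using pos_square[of "h * k"] h(1) k(1) h_k_commute by simp
qed

lemma pos_nrm_le:
  assumes pos_p: "pos p" and pos_diff: "pos (t *\<^sub>R 1 - p)" and t_nonneg: "0 \<le> t"
  shows "nrm p \<le> t"
proof -
  obtain h where h: "h \<in> B" "st h = h" "p = h * h" using pos_p by (rule posE)
  obtain r where r: "pos r" "r * r = t *\<^sub>R 1 - p" "r \<in> bicommutant (t *\<^sub>R 1 - p)"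
    using pos_sqrt[OF pos_diff] by blast
  then show ?thesis
    using nrm_le_if_complementary_squares[OF h(1,2) t_nonneg] h(3) by simp
qed

lemma pos_nrm_mono:
  assumes "pos p" "pos q" shows "nrm p \<le> nrm (p + q)"
proof (rule field_le_epsilon)
  fix e :: real assume e_pos: "0 < e"
  define t where "t = nrm (p + q) + e"
  have t_pos: "0 < t" using e_pos assms by (simp add: t_def add_nonneg_pos)
  have "pos (t *\<^sub>R 1 - (p + q))" using assms t_pos e_pos by (intro pos_scalar_minus) (auto simp: t_def)
  then have "pos (t *\<^sub>R 1 - (p + q) + q)" using pos_add assms by blast
  then have "pos (t *\<^sub>R 1 - p)" by simp
  then show "nrm p \<le> nrm (p + q) + e" using pos_nrm_le assms t_pos by (simp add: t_def)
qed

lemma pos_add_eq_0: "\<lbrakk>pos p; pos q; p + q = 0\<rbrakk> \<Longrightarrow> p = 0"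
  using pos_nrm_mono[of p q] nrm_pos[of p] by force

subsection \<open>Inverses\<close>

definition is_inverse :: "'b \<Rightarrow> 'b \<Rightarrow> bool" where
  "is_inverse a y \<longleftrightarrow> y \<in> B \<and> a * y = 1 \<and> y * a = 1"

lemma is_inverse_bicommutant:
  assumes "is_inverse a y"
  shows "y \<in> bicommutant a"
proof -
  have "z * y = y * z" if "z * a = a * z" for z
    using assms that unfolding is_inverse_def by (metis mult.assoc mult_1_left mult_1_right)
  then show ?thesis using assms by (simp add: bicommutant_def is_inverse_def)
qed

lemma is_inverse_sa:
  assumes "is_inverse a y" "a \<in> B" "st a = a"
  shows "st y = y"
proof -
  have "st y * a = st (a * y)" using assms by (subst st_mult) (auto simp: is_inverse_def)
  then have "st y * a = 1" using assms(1) by (simp add: is_inverse_def)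
  then show ?thesis using assms(1) unfolding is_inverse_def by (metis mult.assoc mult_1_left mult_1_right)
qed

lemma geometric_series_conv:
  assumes x: "x \<in> B" "nrm x < 1"
  obtains y where "conv (\<lambda>n. \<Sum>k<n. x ^ k) y"
proof (rule conv_if_dominated_increments)
  have power_closed: "x ^ n \<in> B" for n by (induction n) (use x in auto)
  show "(\<Sum>k<n. x ^ k) \<in> B" for n by (induction n) (auto simp: power_closed)
  show "convergent (\<lambda>n. \<Sum>k<n. nrm x ^ k)"
    using summable_geometric[of "nrm x"] x by (simp add: summable_iff_convergent)
  have "nrm (x ^ n) \<le> nrm x ^ n" for n
  proof (induction n)
    case (Suc n)
    have "nrm (x ^ Suc n) \<le> nrm x * nrm (x ^ n)" using nrm_mult x power_closed by simp
    also have "\<dots> \<le> nrm x * nrm x ^ n" using Suc x by (intro mult_left_mono) auto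
    finally show ?case by simp
  qed (simp add: nrm_one)
  then show "nrm ((\<Sum>k<Suc n. x ^ k) - (\<Sum>k<n. x ^ k)) \<le> (\<Sum>k<Suc n. nrm x ^ k) - (\<Sum>k<n. nrm x ^ k)" for n
    by simp
qed

lemma neumann_inverse:
  assumes x: "x \<in> B" "nrm x < 1"
  obtains y where "is_inverse (1 - x) y"
proof -
  define f where "f n = (\<Sum>k<n. x ^ k)" for n
  obtain y where lim: "conv f y" using geometric_series_conv[OF x] unfolding f_def by blast
  have f_Suc: "f (Suc n) = 1 + x * f n" for n
    unfolding f_def by (subst sum.lessThan_Suc_shift) (simp add: sum_distrib_left)
  have "conv (\<lambda>n. f (Suc n)) (1 + x * y)"
    unfolding f_Suc using lim x by (intro conv_add conv_mult conv_const) auto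
  then have "y = 1 + x * y" using conv_unique conv_Suc[OF lim] by blast
  moreover have "x * f n = f n * x" for n
    by (simp add: f_def sum_distrib_left sum_distrib_right power_commutes)
  then have "x * y = y * x" using commute_limit lim x by blast
  ultimately have "is_inverse (1 - x) y"
    using conv_closed(2)[OF lim] unfolding is_inverse_def by (simp add: algebra_simps)
  then show thesis by (rule that)
qed

lemma pos_one_plus_inverse:
  assumes "pos a" obtains y where "is_inverse (1 + a) y"
proof -
  define t where "t = nrm a"
  have t_nonneg: "0 \<le> t" using assms by (simp add: t_def)
  define x where "x = (1 / (t + 1)) *\<^sub>R (t *\<^sub>R 1 - a)"
  have "nrm x \<le> t / (t + 1)"
    using pos_nrm_scalar_minus[of a t] assms t_nonneg
    by (simp add: x_def nrm_scaleR t_def divide_right_mono)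
  also have "\<dots> < 1" using t_nonneg by simp
  finally obtain z where inverse_z: "is_inverse (1 - x) z"
    using neumann_inverse[of x] assms by (auto simp: x_def)
  have "1 + a = (t + 1) *\<^sub>R 1 - (t *\<^sub>R 1 - a)" by (simp add: algebra_simps)
  also have "\<dots> = (t + 1) *\<^sub>R (1 - x)" using t_nonneg by (simp add: x_def scaleR_diff_right)
  finally have "is_inverse (1 + a) ((1 / (t + 1)) *\<^sub>R z)" using inverse_z t_nonneg by (simp add: is_inverse_def)
  then show thesis by (rule that)
qed

subsection \<open>Positivity of \<open>b\<^sup>* b\<close>\<close>

lemma pos_st_mult_add: assumes d_closed: "d \<in> B" shows "pos (st d * d + d * st d)"
proof -
  define x where "x = d + st d"
  define y where "y = imag * (d - st d)"
  have x: "x \<in> B" "st x = x" using d_closed by (auto simp: x_def add.commute)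
  have y: "y \<in> B" "st y = y"
    using d_closed imag_central[of "d - st d"] by (auto simp: y_def algebra_simps)
  have "y * y = imag * imag * ((d - st d) * (d - st d))"
    unfolding y_def using imag_central[of "d - st d"] d_closed by (metis mult.assoc diff_closed st_closed)
  then have "x * x + y * y = 2 *\<^sub>R (st d * d + d * st d)"
    using imag_imag by (simp add: x_def algebra_simps scaleR_2)
  moreover have "pos ((1/2) *\<^sub>R (x * x + y * y))" by (intro pos_scaleR pos_add pos_square x y) simp
  ultimately show ?thesis by simp
qed

text \<open>If \<open>a = - d\<^sup>* d\<close> and \<open>b = d d\<^sup>*\<close> are both positive and \<open>t\<close> is their common norm, then
  \<open>(t + b) d = d (t - a)\<close> has norm at most \<open>t \<parallel>d\<parallel>\<close>, while
  \<open>(t + b) d d\<^sup>* (t + b) \<ge> 2 t b\<^sup>2\<close> has norm at least \<open>2 t\<^sup>3\<close>.\<close>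

lemma eq_0_if_neg_st_mult_pos:
  assumes d_closed: "d \<in> B" and neg: "pos (- (st d * d))"
  shows "d = 0"
proof (rule ccontr)
  assume "d \<noteq> 0"
  define b where "b = d * st d"
  define t where "t = (nrm d)\<^sup>2"
  define c where "c = (t *\<^sub>R 1 + b) * d"
  have t_pos: "0 < t" using \<open>d \<noteq> 0\<close> nrm_pos[OF d_closed] by (simp add: t_def)
  have "pos (st d * d + d * st d + - (st d * d))" by (intro pos_add pos_st_mult_add d_closed neg)
  then have pos_b: "pos b" by (simp add: b_def)
  have c_closed: "c \<in> B" using d_closed pos_b by (simp add: c_def)
  have nrm_b: "nrm b = t" using nrm_st_mult[of "st d"] d_closed by (simp add: b_def t_def)
  have "c = d * (t *\<^sub>R 1 - - (st d * d))" by (simp add: c_def b_def algebra_simps)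
  also have "nrm \<dots> \<le> nrm d * nrm (t *\<^sub>R 1 - - (st d * d))" using d_closed by (intro nrm_mult) auto
  also have "\<dots> \<le> nrm d * t"
    using d_closed neg by (intro mult_left_mono pos_nrm_scalar_minus) (auto simp: nrm_st_mult t_def)
  finally have "nrm c \<le> nrm d * t" .
  then have "(nrm c)\<^sup>2 \<le> (nrm d * t)\<^sup>2" using c_closed by (intro power_mono) auto
  then have upper: "(nrm c)\<^sup>2 \<le> t ^ 3"
    by (simp add: power_mult_distrib t_def power2_eq_square power3_eq_cube mult_ac)
  have "(nrm c)\<^sup>2 = nrm (st (st c) * st c)" using nrm_st_mult[of "st c"] c_closed by simp
  also have "st (st c) * st c = (t *\<^sub>R 1 + b) * b * (t *\<^sub>R 1 + b)"
    using d_closed pos_b by (simp add: c_def b_def mult.assoc)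
  also have "\<dots> = (2 * t) *\<^sub>R (b * b) + (t\<^sup>2 *\<^sub>R b + b * (b * b))"
    by (simp add: algebra_simps power2_eq_square flip: scaleR_2)
  finally have "(nrm c)\<^sup>2 = nrm ((2 * t) *\<^sub>R (b * b) + (t\<^sup>2 *\<^sub>R b + b * (b * b)))" .
  moreover have "nrm ((2 * t) *\<^sub>R (b * b)) \<le> nrm ((2 * t) *\<^sub>R (b * b) + (t\<^sup>2 *\<^sub>R b + b * (b * b)))"
    using pos_b t_pos by (intro pos_nrm_mono pos_scaleR pos_add pos_mult_if_commute pos_square)
      (auto simp: mult.assoc)
  ultimately have "2 * t ^ 3 \<le> (nrm c)\<^sup>2"
    using pos_b nrm_b t_pos by (simp add: nrm_scaleR nrm_square power2_eq_square power3_eq_cube)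
  moreover have "0 < t ^ 3" using t_pos by simp
  ultimately show False using upper by linarith
qed

text \<open>Writing \<open>v = |c| - c\<close> for \<open>c = b\<^sup>* b\<close>, one has \<open>v c v = - v\<^sup>3 / 2\<close> and \<open>v\<^sup>3 \<ge> 0\<close>, so the
  previous lemma applies to \<open>b v\<close>.\<close>

theorem pos_st_mult: assumes b_closed: "b \<in> B" shows "pos (st b * b)"
proof -
  define c where "c = st b * b"
  have c: "c \<in> B" "st c = c" using b_closed by (auto simp: c_def)
  obtain m where m: "pos m" "m * m = c * c" "m \<in> bicommutant (c * c)"
    using pos_sqrt[OF pos_square[OF c]] by blast
  have c_m_commute: "c * m = m * c" using bicommutant_commute[OF m(3) c(1)] by (simp add: mult.assoc)
  define v where "v = m - c"
  have v: "v \<in> B" "st v = v" using m c by (auto simp: v_def)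
  have v_m_commute: "v * m = m * v" using c_m_commute by (simp add: v_def algebra_simps)
  have v_square: "v * v = 2 *\<^sub>R (m * v)" and c_v: "c * v = - (m * v)"
    using c_m_commute m(2) by (simp_all add: v_def algebra_simps scaleR_2)
  have "st (b * v) * (b * v) = v * (c * v)" using b_closed v by (simp add: c_def mult.assoc)
  also have "\<dots> = - (m * (v * v))" using c_v v_m_commute by (metis mult.assoc mult_minus_right)
  finally have "- (st (b * v) * (b * v)) = m * (v * v)" by simp
  moreover have "pos (m * (v * v))"
    using pos_mult_if_commute[OF m(1) pos_square[OF v]] v_m_commute by (metis mult.assoc)
  ultimately have "b * v = 0" using eq_0_if_neg_st_mult_pos[of "b * v"] b_closed v by simp
  then have "c * v = 0" by (simp add: c_def mult.assoc)
  then have "v * v * v = 0" using c_v v_square by simp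
  then have "v = 0" using cube_eq_0 v by blast
  then show ?thesis using m(1) by (simp add: v_def c_def)
qed

lemma pos_conj: assumes "pos a" "c \<in> B" shows "pos (st c * a * c)"
proof -
  obtain h where h: "h \<in> B" "st h = h" "a = h * h" using assms(1) by (rule posE)
  have "st c * a * c = st (h * c) * (h * c)" using h assms(2) by (simp add: mult.assoc)
  then show ?thesis using pos_st_mult[of "h * c"] h assms(2) by simp
qed

lemma pos_eq_if_square_eq_commute:
  assumes pos_x: "pos x" and pos_y: "pos y"
    and x_y_commute: "x * y = y * x" and squares_eq: "x * x = y * y"
  shows "x = y"
proof -
  define d where "d = x - y"
  have d: "d \<in> B" "st d = d" "d * x = x * d" "d * y = y * d"
    using pos_x pos_y x_y_commute by (auto simp: d_def algebra_simps)
  have "(x + y) * d = 0" using x_y_commute squares_eq by (simp add: d_def algebra_simps)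
  then have "x * (d * d) + y * (d * d) = 0" by (metis distrib_right mult.assoc mult_zero_left)
  moreover have "pos (x * (d * d))" "pos (y * (d * d))"
    using pos_mult_if_commute[OF pos_x pos_square] pos_mult_if_commute[OF pos_y pos_square] d
    by (metis mult.assoc)+
  ultimately have "x * (d * d) = 0" "y * (d * d) = 0"
    using pos_add_eq_0 by (metis add.commute)+
  then have "d * d * d = 0" using d(3,4) by (subst d_def) (simp add: algebra_simps)
  then have "d = 0" using cube_eq_0 d by blast
  then show ?thesis by (simp add: d_def)
qed

lemma pos_sqrt_unique:
  assumes "pos r" "pos s" "r * r = s * s" shows "r = s"
proof -
  obtain m where m: "pos m" "m * m = s * s" "m \<in> bicommutant (s * s)"
    using pos_sqrt[OF pos_square[of s]] assms(2) by auto
  have "x = m" if x: "pos x" "x * x = s * s" for x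
  proof (rule pos_eq_if_square_eq_commute[OF x(1) m(1)])
    show "x * m = m * x" using bicommutant_commute[OF m(3), of x] x by (metis mult.assoc pos_closed)
  qed (use x m in simp)
  then show ?thesis using assms by metis
qed

definition is_modulus :: "'b \<Rightarrow> 'b \<Rightarrow> bool" where
  "is_modulus s a \<longleftrightarrow> pos s \<and> s * s = st a * a"

lemma is_modulus_unique: "\<lbrakk>is_modulus r a; is_modulus s a\<rbrakk> \<Longrightarrow> r = s"
  using pos_sqrt_unique by (simp add: is_modulus_def)

section \<open>Matched projections of idempotents\<close>

definition is_mp_inverse :: "'b \<Rightarrow> 'b \<Rightarrow> bool" where
  "is_mp_inverse a x \<longleftrightarrow>
     x \<in> B \<and> a * x * a = a \<and> x * a * x = x \<and> st (a * x) = a * x \<and> st (x * a) = x * a"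

lemma is_mp_inverse_unique:
  assumes a_closed: "a \<in> B" and mp_x: "is_mp_inverse a x" and mp_y: "is_mp_inverse a y"
  shows "x = y"
proof -
  have "a * x = st (a * y * (a * x))" using mp_x mp_y by (metis is_mp_inverse_def mult.assoc)
  also have "\<dots> = a * x * (a * y)" using a_closed mp_x mp_y by (subst st_mult) (auto simp: is_mp_inverse_def)
  also have "\<dots> = a * y" using mp_x by (metis is_mp_inverse_def mult.assoc)
  finally have a_x_eq: "a * x = a * y" .
  have "x * a = st (x * a * (y * a))" using mp_x mp_y by (metis is_mp_inverse_def mult.assoc)
  also have "\<dots> = y * a * (x * a)" using a_closed mp_x mp_y by (subst st_mult) (auto simp: is_mp_inverse_def)
  also have "\<dots> = y * a" using mp_x by (metis is_mp_inverse_def mult.assoc)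
  finally have "x * a = y * a" .
  with a_x_eq show ?thesis using mp_x mp_y by (metis is_mp_inverse_def mult.assoc)
qed

definition is_range_projection :: "'b \<Rightarrow> 'b \<Rightarrow> bool" where
  "is_range_projection p q \<longleftrightarrow> p \<in> B \<and> st p = p \<and> p * q = q \<and> q * p = p"

lemma is_range_projection_idem: "is_range_projection p q \<Longrightarrow> p * p = p"
  unfolding is_range_projection_def by (metis mult.assoc)

text \<open>With \<open>z = 1 + (q - q\<^sup>* )\<^sup>* (q - q\<^sup>* )\<close> one has \<open>q z = q q\<^sup>* q = z q\<close>, so the projection is
  \<open>q q\<^sup>* z\<^sup>-\<^sup>1\<close>.\<close>

lemma idempotent_range_projection:
  assumes q: "q \<in> B" "q * q = q"
  obtains p where "is_range_projection p q"
proof -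
  define z where "z = 1 + st (q - st q) * (q - st q)"
  have z_sa: "z \<in> B" "st z = z" using q by (simp_all add: z_def)
  obtain y where inverse_y: "is_inverse z y"
    using pos_one_plus_inverse[OF pos_st_mult[of "q - st q"]] q by (auto simp: z_def)
  have y_sa: "y \<in> B" "st y = y" using inverse_y z_sa by (auto simp: is_inverse_sa is_inverse_def)
  have idem_st: "st q * st q = st q" using q st_mult[of q q] by simp
  have cancel: "q * (q * u) = q * u" "st q * (st q * u) = st q * u" for u
    using q idem_st by (simp_all flip: mult.assoc)
  have q_z: "q * z = q * st q * q" "z * q = q * st q * q"
    using q idem_st cancel by (simp_all add: z_def algebra_simps)
  have st_qz: "st q * z = z * st q" using q idem_st cancel by (simp add: z_def algebra_simps)
  have q_y_commute: "q * y = y * q" "st q * y = y * st q"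
    using bicommutant_commute[OF is_inverse_bicommutant[OF inverse_y]] q q_z st_qz by simp_all
  define p where "p = q * st q * y"
  have "p * q = q * st q * q * y" by (simp add: p_def q_y_commute(1) mult.assoc)
  also have "\<dots> = q * z * y" by (simp add: q_z)
  also have "\<dots> = q" using inverse_y by (simp add: is_inverse_def mult.assoc)
  finally have "p * q = q" .
  moreover have "st p = p" using q y_sa q_y_commute by (simp add: p_def) (metis mult.assoc)
  moreover have "q * p = p" "p \<in> B" using q y_sa by (simp_all add: p_def cancel mult.assoc)
  ultimately have "is_range_projection p q" by (simp add: is_range_projection_def)
  then show thesis by (rule that)
qed

lemma is_range_projection_reflect:
  assumes "is_range_projection p q"
  shows "is_range_projection p (2 *\<^sub>R p - q)"
  using assms is_range_projection_idem[OF assms]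
  by (simp add: is_range_projection_def algebra_simps scaleR_2)

lemma range_projection_products:
  assumes "q \<in> B" "is_range_projection p q"
  shows "p * (q - p) = q - p" "(q - p) * p = 0" "p * st (q - p) = 0" "st (q - p) * p = st (q - p)"
proof -
  have p: "p \<in> B" "st p = p" "p * q = q" "q * p = p"
    using assms(2) by (auto simp: is_range_projection_def)
  show left: "p * (q - p) = q - p" and right: "(q - p) * p = 0"
    using p is_range_projection_idem[OF assms(2)] by (simp_all add: algebra_simps)
  have "p * st (q - p) = st ((q - p) * p)" "st (q - p) * p = st (p * (q - p))"
    using assms(1) p(1,2) by (simp_all add: algebra_simps)
  then show "p * st (q - p) = 0" "st (q - p) * p = st (q - p)" unfolding left right by simp_all
qed

lemma idempotent_mult_st:
  assumes "q \<in> B" "is_range_projection p q"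
  shows "q * st q = p + (q - p) * st (q - p)"
proof -
  define n where "n = q - p"
  have "q = p + n" "st q = p + st n"
    using assms by (simp_all add: n_def is_range_projection_def)
  then show ?thesis
    using range_projection_products[OF assms] is_range_projection_idem[OF assms(2)]
    by (simp add: algebra_simps flip: n_def)
qed

lemma is_modulus_reflect:
  assumes q: "q \<in> B" and p: "is_range_projection p q" and s: "is_modulus s (st q)"
  shows "is_modulus s (st (2 *\<^sub>R p - q))"
proof -
  have reflect: "2 *\<^sub>R p - q \<in> B" "2 *\<^sub>R p - q - p = - (q - p)" "q - p \<in> B"
    using q p by (auto simp: is_range_projection_def scaleR_2)
  have "(2 *\<^sub>R p - q) * st (2 *\<^sub>R p - q) = q * st q"
    unfolding idempotent_mult_st[OF q p]
      idempotent_mult_st[OF reflect(1) is_range_projection_reflect[OF p]] reflect(2)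
    by (simp only: st_minus[OF reflect(3)] minus_mult_minus)
  then show ?thesis using s q reflect(1) by (simp add: is_modulus_def)
qed

lemma is_inverse_sqrt:
  assumes r: "r \<in> B" and inverse: "is_inverse (r * r) y"
  shows "is_inverse r (r * y)"
proof -
  have "r * y = y * r"
    using bicommutant_commute[OF is_inverse_bicommutant[OF inverse] r] by (simp add: mult.assoc)
  then show ?thesis using inverse r unfolding is_inverse_def by (metis mult.assoc mult_closed)
qed

lemma is_mp_inverse_projection_mult:
  assumes p: "p \<in> B" "st p = p" "p * p = p"
    and inverse_v: "is_inverse r v" and p_r_commute: "p * r = r * p"
  shows "is_mp_inverse (p * r) (p * v)" "(p * r) * (p * v) = p" "(p * v) * (p * r) = p"
proof -
  have p_v_commute: "p * v = v * p"
    using bicommutant_commute[OF is_inverse_bicommutant[OF inverse_v] p(1) p_r_commute] .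
  show left: "(p * r) * (p * v) = p" and right: "(p * v) * (p * r) = p"
    using p_r_commute p_v_commute inverse_v p(3) unfolding is_inverse_def by (metis mult.assoc mult_1_right)+
  have "p * (p * r) = p * r" "p * (p * v) = p * v" by (simp_all add: p(3) flip: mult.assoc)
  then show "is_mp_inverse (p * r) (p * v)"
    using p inverse_v by (simp add: is_mp_inverse_def left right is_inverse_def)
qed

text \<open>The modulus of \<open>q\<^sup>*\<close> is \<open>p r\<close> for the invertible \<open>r = \<surd>(1 + (q - p) (q - p)\<^sup>* )\<close>, which
  commutes with \<open>p\<close>.\<close>

lemma idempotent_modulus:
  assumes q: "q \<in> B" and p: "is_range_projection p q"
  obtains s x where "is_modulus s (st q)" "is_mp_inverse s x" "s * x = p" "x * s = p"
proof -
  have p_proj: "p \<in> B" "st p = p" "p * p = p"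
    using p is_range_projection_idem[OF p] by (auto simp: is_range_projection_def)
  define m where "m = (q - p) * st (q - p)"
  have pos_m: "pos m" using pos_st_mult[of "st (q - p)"] q p_proj by (simp add: m_def)
  have p_absorb: "p * m = m" "m * p = m"
    using range_projection_products[OF q p] unfolding m_def by (metis mult.assoc)+
  obtain r where r: "pos r" "r * r = 1 + m" "r \<in> bicommutant (1 + m)"
    using pos_sqrt[OF pos_add[OF pos_one pos_m]] by blast
  obtain y where "is_inverse (1 + m) y" using pos_one_plus_inverse[OF pos_m] by blast
  then have inverse_v: "is_inverse r (r * y)" using is_inverse_sqrt r(1,2) by simp
  have p_r_commute: "p * r = r * p"
    using bicommutant_commute[OF r(3) p_proj(1)] p_absorb by (simp add: algebra_simps)
  have "(p * r) * (p * r) = p * (r * r)" using p_r_commute p_proj(3) by (metis mult.assoc)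
  also have "\<dots> = q * st q"
    unfolding r(2) idempotent_mult_st[OF q p] by (simp add: p_absorb distrib_left flip: m_def)
  finally have "(p * r) * (p * r) = q * st q" .
  moreover have "pos p" using pos_square[of p] p_proj by simp
  then have "pos (p * r)" using r(1) p_r_commute by (rule pos_mult_if_commute)
  ultimately have "is_modulus (p * r) (st q)" using q by (simp add: is_modulus_def)
  then show thesis using is_mp_inverse_projection_mult[OF p_proj inverse_v p_r_commute] by (rule that)
qed

lemma is_mp_inverse_absorb:
  assumes "is_mp_inverse s x" "s * x = p" "x * s = p"
  shows "p * s = s" "s * p = s" "p * x = x" "x * p = x"
  using assms unfolding is_mp_inverse_def by (metis mult.assoc)+

definition matched :: "'b \<Rightarrow> 'b \<Rightarrow> 'b \<Rightarrow> 'b \<Rightarrow> 'b" where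
  "matched s x e q = (1/2) *\<^sub>R ((s + st q) * x * e * (s + q))"

lemma matched_expand:
  assumes q: "q \<in> B" and p: "is_range_projection p q" and s: "s \<in> B"
    and x: "is_mp_inverse s x" and s_x: "s * x = p" and x_s: "x * s = p"
    and e: "is_inverse (s + 1) e"
  shows "matched s x e q = (1/2) *\<^sub>R (p + x + x * (q - p) + st (q - p) * x
    + st (q - p) * (x * e) * (q - p))"
proof -
  note absorb = is_mp_inverse_absorb[OF x s_x x_s]
  have x_closed: "x \<in> B" using x by (simp add: is_mp_inverse_def)
  have "x * (s + 1) = (s + 1) * x" by (simp add: distrib_left distrib_right s_x x_s)
  then have x_e_commute: "x * e = e * x"
    using bicommutant_commute[OF is_inverse_bicommutant[OF e] x_closed] by simp
  define g where "g = x * e"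
  have "s + p = (s + 1) * p" "s + p = p * (s + 1)" by (simp_all add: distrib_left distrib_right absorb)
  then have g_absorb: "g * (s + p) = x" "(s + p) * g = x"
    using e absorb x_e_commute unfolding g_def is_inverse_def by (metis mult.assoc mult_1_right mult_1_left)+
  define n where "n = q - p"
  have "s + q = (s + p) + n" "s + st q = (s + p) + st n"
    using q p by (simp_all add: n_def is_range_projection_def)
  then have "(s + st q) * x * e * (s + q)
      = (s + p) * (g * (s + p)) + (s + p) * g * n + st n * (g * (s + p)) + st n * g * n"
    by (simp add: g_def distrib_left distrib_right mult.assoc)
  also have "\<dots> = p + x + x * n + st n * x + st n * g * n"
    unfolding g_absorb by (simp add: distrib_right s_x absorb)
  finally show ?thesis by (simp add: matched_def g_def n_def)
qed

theorem matched_reflect: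
  assumes q: "q \<in> B" and p: "is_range_projection p q" and s: "s \<in> B"
    and x: "is_mp_inverse s x" "s * x = p" "x * s = p" and e: "is_inverse (s + 1) e"
  shows "matched s x e (2 *\<^sub>R p - q) = matched s x e q + (1 - st q) * x + x * (1 - q)"
proof -
  have p_sa: "p \<in> B" "st p = p" using p by (auto simp: is_range_projection_def)
  define n where "n = q - p"
  have n_closed: "n \<in> B" using q p_sa by (simp add: n_def)
  have reflect: "2 *\<^sub>R p - q \<in> B" "2 *\<^sub>R p - q - p = - n" using q p_sa by (simp_all add: n_def scaleR_2)
  have "matched s x e q - matched s x e (2 *\<^sub>R p - q)
      = (1/2) *\<^sub>R ((p + x + x * n + st n * x + st n * (x * e) * n)
        - (p + x - x * n - st n * x + st n * (x * e) * n))"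
    using matched_expand[OF q p s x e] n_closed
      matched_expand[OF reflect(1) is_range_projection_reflect[OF p] s x e]
    unfolding reflect(2) by (simp flip: n_def scaleR_diff_right)
  also have "\<dots> = x * n + st n * x" by (simp add: algebra_simps flip: scaleR_add_left)
  finally have "matched s x e (2 *\<^sub>R p - q) = matched s x e q - st n * x - x * n"
    by (simp add: algebra_simps)
  moreover have "(1 - st q) * x = - (st n * x)" "x * (1 - q) = - (x * n)"
    using q p_sa is_mp_inverse_absorb[OF x]
    by (simp_all add: n_def left_diff_distrib right_diff_distrib)
  ultimately show ?thesis by simp
qed

end

section \<open>The C*-algebra of adjointable operators\<close>

interpretation cscale: vector_space "cscale :: complex \<Rightarrow> 'm \<Rightarrow> 'm::complex_vs"
  by standard
    (simp_all add: cscale_add_right cscale_add_left cscale_cscale cscale_of_real[of 1, simplified])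

interpretation cscale: vector_space_pair
    "cscale :: complex \<Rightarrow> 'm \<Rightarrow> 'm::complex_vs" "cscale :: complex \<Rightarrow> 'm \<Rightarrow> 'm"
  by unfold_locales

typedef (overloaded) 'm clin = "{f :: 'm \<Rightarrow> 'm::complex_vs. Vector_Spaces.linear cscale cscale f}"
  morphisms app Clin
  using cscale.linear_id by blast

setup_lifting type_definition_clin

interpretation app: Vector_Spaces.linear cscale cscale "app f" for f :: "'m::complex_vs clin"
  using app[of f] by simp

lemma app_scaleR: "app f (r *\<^sub>R x) = r *\<^sub>R app f x"
  by (simp flip: cscale_of_real add: app.scale)

instantiation clin :: (complex_vs) "{real_algebra, monoid_mult}"
begin

lift_definition zero_clin :: "'a clin" is "\<lambda>x. 0" by (rule cscale.linear_zero)
lift_definition one_clin :: "'a clin" is "id" by (rule cscale.linear_id)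
lift_definition plus_clin :: "'a clin \<Rightarrow> 'a clin \<Rightarrow> 'a clin" is op_add
  unfolding op_add_def by (rule cscale.linear_compose_add)
lift_definition minus_clin :: "'a clin \<Rightarrow> 'a clin \<Rightarrow> 'a clin" is op_diff
  unfolding op_diff_def by (rule cscale.linear_compose_sub)
lift_definition uminus_clin :: "'a clin \<Rightarrow> 'a clin" is "\<lambda>f x. - f x"
  by (rule cscale.linear_compose_neg)
lift_definition times_clin :: "'a clin \<Rightarrow> 'a clin \<Rightarrow> 'a clin" is "(\<circ>)"
  by (rule Vector_Spaces.linear_compose)
lift_definition scaleR_clin :: "real \<Rightarrow> 'a clin \<Rightarrow> 'a clin" is op_scale
  unfolding op_scale_def cscale_of_real[symmetric] by (rule cscale.linear_compose_scale_right)

lemmas app_simps = plus_clin.rep_eq minus_clin.rep_eq times_clin.rep_eq scaleR_clin.rep_eq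
  one_clin.rep_eq zero_clin.rep_eq uminus_clin.rep_eq

lemmas app_apply = app_simps op_add_def op_diff_def op_scale_def

instance
proof
  fix a b c :: "'a clin" and r s :: real
  show "a + b + c = a + (b + c)" "a + b = b + a" "0 + a = a" "- a + a = 0" "a - b = a + - b"
    "r *\<^sub>R (a + b) = r *\<^sub>R a + r *\<^sub>R b" "(r + s) *\<^sub>R a = r *\<^sub>R a + s *\<^sub>R a"
    "r *\<^sub>R s *\<^sub>R a = (r * s) *\<^sub>R a" "1 *\<^sub>R a = a"
    "a * b * c = a * (b * c)" "1 * a = a" "a * 1 = a"
    "(a + b) * c = a * c + b * c" "a * (b + c) = a * b + a * c"
    "r *\<^sub>R a * b = r *\<^sub>R (a * b)" "a * r *\<^sub>R b = r *\<^sub>R (a * b)"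
    by (simp_all add: app_inject[symmetric] app_apply fun_eq_iff app.add app_scaleR
        scaleR_add_left scaleR_add_right)
qed

end

lift_definition imag_clin :: "'m::complex_vs clin" is "cscale \<i>"
  by (rule cscale.linear_scale_self)

locale sesquilinear_definite =
  fixes ip :: "'m::complex_vs \<Rightarrow> 'm \<Rightarrow> 'a::cstar_algebra"
  assumes ip_add_right: "ip x (y + z) = ip x y + ip x z"
    and ip_cscale_right: "ip x (cscale c y) = cscale c (ip x y)"
    and ip_sym: "ip y x = cstar (ip x y)"
    and ip_definite: "ip x x = 0 \<Longrightarrow> x = 0"
begin

abbreviation hnorm :: "'m \<Rightarrow> real" where "hnorm \<equiv> hmod_norm ip"

lemma ip_add_left: "ip (x + y) z = ip x z + ip y z"
  by (metis ip_add_right ip_sym cstar_add)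

lemma ip_cscale_left: "ip (cscale c x) y = cscale (cnj c) (ip x y)"
  by (metis ip_cscale_right ip_sym cstar_cscale)

lemma ip_scaleR_right: "ip x (r *\<^sub>R y) = r *\<^sub>R ip x y"
  by (metis ip_cscale_right cscale_of_real)

lemma ip_scaleR_left: "ip (r *\<^sub>R x) y = r *\<^sub>R ip x y"
  by (metis ip_cscale_left cscale_of_real complex_cnj_complex_of_real)

lemma ip_diff_right: "ip x (y - z) = ip x y - ip x z"
  using ip_add_right[of x "y - z" z] by simp

lemma ip_diff_left: "ip (x - y) z = ip x z - ip y z"
  using ip_add_left[of "x - y" y z] by simp

lemma ip_right_eqI: "(\<And>z. ip z x = ip z y) \<Longrightarrow> x = y"
  using ip_definite[of "x - y"] by (simp add: ip_diff_right)

lemma hnorm_nonneg [simp]: "0 \<le> hnorm x"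
  by (simp add: hmod_norm_def)

lemma hnorm_square: "(hnorm x)\<^sup>2 = norm (ip x x)"
  by (simp add: hmod_norm_def)

lemma hnorm_eq_0 [simp]: "hnorm x = 0 \<longleftrightarrow> x = 0"
  using ip_definite[of x] ip_scaleR_right[of 0 0 0] by (auto simp: hmod_norm_def)

lemma hnorm_zero [simp]: "hnorm 0 = 0"
  by simp

lemma hnorm_pos: "x \<noteq> 0 \<Longrightarrow> 0 < hnorm x"
  using hnorm_nonneg[of x] by (simp add: less_le del: hnorm_nonneg)

lemma hnorm_scaleR: "hnorm (r *\<^sub>R x) = \<bar>r\<bar> * hnorm x"
  by (simp add: hmod_norm_def ip_scaleR_left ip_scaleR_right real_sqrt_mult real_sqrt_abs2)

lemma hnorm_minus: "hnorm (- x) = hnorm x"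
  using hnorm_scaleR[of "-1" x] by simp

lemma hnorm_diff_commute: "hnorm (x - y) = hnorm (y - x)"
  using hnorm_minus[of "x - y"] by simp

lemma hnorm_le_if_ip_le:
  assumes "0 \<le> K" "\<And>y. norm (ip x y) \<le> K * hnorm y" shows "hnorm x \<le> K"
  by (rule le_if_square_le_mult) (use assms in \<open>simp_all add: hnorm_square\<close>)

end

locale complete_inner = sesquilinear_definite ip
  for ip :: "'m::complex_vs \<Rightarrow> 'm \<Rightarrow> 'a::cstar_algebra" +
  assumes cauchy_schwarz: "norm (ip x y) \<le> hmod_norm ip x * hmod_norm ip y"
    and hmod_complete: "\<forall>e>0. \<exists>M. \<forall>m\<ge>M. \<forall>n\<ge>M. hmod_norm ip (f m - f n) < e
        \<Longrightarrow> \<exists>x. (\<lambda>n::nat. hmod_norm ip (f n - x)) \<longlonglongrightarrow> 0"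
begin

lemma hnorm_triangle: "hnorm (x + y) \<le> hnorm x + hnorm y"
proof (rule power2_le_imp_le)
  have "(hnorm (x + y))\<^sup>2 = norm (ip x x + ip x y + (ip y x + ip y y))"
    by (simp add: hnorm_square ip_add_left ip_add_right add_ac)
  also have "\<dots> \<le> norm (ip x x) + norm (ip x y) + (norm (ip y x) + norm (ip y y))"
    by (intro norm_triangle_mono order_refl)
  also have "\<dots> \<le> (hnorm x + hnorm y)\<^sup>2"
    using cauchy_schwarz[of x y] cauchy_schwarz[of y x]
    by (simp add: power2_sum mult.commute[of "hnorm y" "hnorm x"] flip: hnorm_square)
  finally show "(hnorm (x + y))\<^sup>2 \<le> (hnorm x + hnorm y)\<^sup>2" .
qed simp

lemma hnorm_triangle_diff: "hnorm (x - z) \<le> hnorm (x - y) + hnorm (y - z)"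
  using hnorm_triangle[of "x - y" "y - z"] by simp

lemma ip_tendsto_left:
  assumes "(\<lambda>n. hnorm (f n - x)) \<longlonglongrightarrow> 0" shows "(\<lambda>n. ip (f n) y) \<longlonglongrightarrow> ip x y"
proof -
  have "(\<lambda>n. hnorm (f n - x) * hnorm y) \<longlonglongrightarrow> 0" using tendsto_mult_right[OF assms, of "hnorm y"] by simp
  then have "(\<lambda>n. ip (f n) y - ip x y) \<longlonglongrightarrow> 0"
    by (rule Lim_null_comparison[rotated]) (simp add: cauchy_schwarz flip: ip_diff_left)
  then show ?thesis by (simp add: LIM_zero_iff)
qed

lemma ip_tendsto_right:
  assumes "(\<lambda>n. hnorm (f n - x)) \<longlonglongrightarrow> 0" shows "(\<lambda>n. ip y (f n)) \<longlonglongrightarrow> ip y x"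
proof -
  have "(\<lambda>n. hnorm y * hnorm (f n - x)) \<longlonglongrightarrow> 0" using tendsto_mult_left[OF assms, of "hnorm y"] by simp
  then have "(\<lambda>n. ip y (f n) - ip y x) \<longlonglongrightarrow> 0"
    by (rule Lim_null_comparison[rotated]) (simp add: cauchy_schwarz flip: ip_diff_right)
  then show ?thesis by (simp add: LIM_zero_iff)
qed

lemma adj_eqI: "(\<And>x y. ip (T x) y = ip x (S y)) \<Longrightarrow> adj ip T = S"
  unfolding adj_def by (rule the_equality) (auto intro!: ext ip_right_eqI)

lemma ip_adj: "adjointable ip T \<Longrightarrow> ip (T x) y = ip x (adj ip T y)"
  using adj_eqI by (metis adjointable_def)

lemma ip_adj': "adjointable ip T \<Longrightarrow> ip (adj ip T x) y = ip x (T y)"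
  by (metis ip_adj ip_sym)

lemma adjointable_adj: "adjointable ip T \<Longrightarrow> adjointable ip (adj ip T)"
  using ip_adj' unfolding adjointable_def by blast

lemma adjointable_clin:
  assumes "adjointable ip T" obtains a where "T = app a"
proof -
  have "T (x + y) = T x + T y" for x y
    by (rule ip_right_eqI) (simp add: ip_add_right flip: ip_adj'[OF assms])
  moreover have "T (cscale c x) = cscale c (T x)" for c x
    by (rule ip_right_eqI) (simp add: ip_cscale_right flip: ip_adj'[OF assms])
  ultimately have "Vector_Spaces.linear cscale cscale T"
    by (simp add: Vector_Spaces.linear_iff cscale.vector_space_axioms)
  then show thesis using that[of "Clin T"] by (simp add: Clin_inverse)
qed

subsection \<open>Boundedness\<close>

interpretation hnorm: Metric_space UNIV "\<lambda>x y. hnorm (x - y)"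
  by standard (auto simp: hnorm_diff_commute intro: hnorm_triangle_diff)

lemma mcomplete_hnorm: "hnorm.mcomplete"
  unfolding hnorm.mcomplete_def hnorm.MCauchy_def hnorm.limitin_metric_dist_null
  using hmod_complete by simp

lemma closedin_adjointable_sublevel:
  assumes T: "adjointable ip T"
  shows "closedin hnorm.mtopology {x. hnorm (T x) \<le> c}"
  unfolding hnorm.metric_closedin_iff_sequentially_closed
proof (intro conjI allI impI)
  fix f l
  assume "range f \<subseteq> {x. hnorm (T x) \<le> c} \<and> limitin hnorm.mtopology f l sequentially"
  then have sublevel: "hnorm (T (f n)) \<le> c" and lim: "(\<lambda>n. hnorm (f n - l)) \<longlonglongrightarrow> 0" for n
    by (auto simp: hnorm.limitin_metric_dist_null)
  have "hnorm (T l) \<le> c"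
  proof (rule hnorm_le_if_ip_le)
    show "0 \<le> c" using sublevel[of 0] hnorm_nonneg order_trans by blast
    fix y
    have "norm (ip (f n) (adj ip T y)) \<le> c * hnorm y" for n
      using cauchy_schwarz[of "T (f n)" y] mult_right_mono[OF sublevel hnorm_nonneg, of n y]
      by (simp add: ip_adj[OF T])
    then have "norm (ip l (adj ip T y)) \<le> c * hnorm y"
      using LIMSEQ_le_const2[OF tendsto_norm[OF ip_tendsto_left[OF lim]]] by blast
    then show "norm (ip (T l) y) \<le> c * hnorm y" by (simp add: ip_adj[OF T])
  qed
  then show "l \<in> {x. hnorm (T x) \<le> c}" by simp
qed simp

lemma bounded_if_bounded_on_mcball:
  assumes r_pos: "0 < r" and ball: "\<And>x. hnorm (x\<^sub>0 - x) \<le> r \<Longrightarrow> hnorm (app a x) \<le> c"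
  shows "hnorm (app a x) \<le> 2 * c / r * hnorm x"
proof (cases "x = 0")
  case False
  then have hnorm_x_pos: "0 < hnorm x" by (rule hnorm_pos)
  define z where "z = (r / hnorm x) *\<^sub>R x"
  have "hnorm z = r" using False hnorm_x_pos r_pos by (simp add: z_def hnorm_scaleR)
  then have "hnorm (app a (x\<^sub>0 + z)) \<le> c" "hnorm (app a x\<^sub>0) \<le> c"
    using r_pos ball[of "x\<^sub>0 + z"] ball[of x\<^sub>0] by (simp_all add: hnorm_minus)
  moreover have "app a z = app a (x\<^sub>0 + z) + - app a x\<^sub>0" by (simp add: app.add)
  ultimately have "hnorm (app a z) \<le> 2 * c"
    using hnorm_triangle[of "app a (x\<^sub>0 + z)" "- app a x\<^sub>0"] by (simp add: hnorm_minus)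
  then have "(r / hnorm x) * hnorm (app a x) \<le> 2 * c"
    using r_pos hnorm_x_pos by (simp add: z_def app_scaleR hnorm_scaleR)
  then show ?thesis using r_pos hnorm_x_pos by (simp add: field_simps)
qed simp

text \<open>Hellinger--Toeplitz: Baire's theorem for the sets on which \<open>\<parallel>T x\<parallel>\<close> is bounded by a given
  integer.\<close>

lemma adjointable_bounded:
  assumes "adjointable ip (app a)"
  obtains K where "0 \<le> K" "\<And>x. hnorm (app a x) \<le> K * hnorm x"
proof -
  define F where "F n = {x. hnorm (app a x) \<le> real n}" for n
  have "\<Union>(range F) = UNIV" using real_arch_simple by (auto simp: F_def)
  then have "hnorm.mtopology interior_of \<Union>(range F) \<noteq> {}"
    by (metis UNIV_not_empty hnorm.topspace_mtopology interior_of_topspace)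
  moreover have "closedin hnorm.mtopology (F n)" for n
    unfolding F_def by (rule closedin_adjointable_sublevel[OF assms])
  ultimately obtain n where "hnorm.mtopology interior_of F n \<noteq> {}"
    using hnorm.metric_Baire_category_alt[OF mcomplete_hnorm, of "range F"] by auto
  then obtain x\<^sub>0 r where r: "0 < r" "hnorm.mcball x\<^sub>0 r \<subseteq> F n"
    using hnorm.in_interior_of_mcball by blast
  have "hnorm (app a x) \<le> real n" if "hnorm (x\<^sub>0 - x) \<le> r" for x
    using r that by (auto simp: F_def)
  then have "hnorm (app a x) \<le> 2 * real n / r * hnorm x" for x
    using bounded_if_bounded_on_mcball r(1) by blast
  then show thesis using that[of "2 * real n / r"] r(1) by simp
qed

subsection \<open>The operator norm\<close>

definition Adj :: "'m clin set" where "Adj = {a. adjointable ip (app a)}"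

lemma Adj_iff: "a \<in> Adj \<longleftrightarrow> adjointable ip (app a)"
  by (simp add: Adj_def)

definition star :: "'m clin \<Rightarrow> 'm clin" where "star a = Clin (adj ip (app a))"

definition op_norm :: "'m clin \<Rightarrow> real" where
  "op_norm a = Inf {K. 0 \<le> K \<and> (\<forall>x. hnorm (app a x) \<le> K * hnorm x)}"

lemma adjointI:
  assumes "\<And>x y. ip (app a x) y = ip x (app b y)"
  shows "a \<in> Adj" "star a = b"
  using assms adj_eqI[of "app a" "app b"] by (auto simp: Adj_iff adjointable_def star_def app_inverse)

lemma app_adjointable:
  assumes "adjointable ip T" obtains a where "a \<in> Adj" "T = app a"
  using assms adjointable_clin[OF assms] by (metis Adj_iff)

lemma app_star: assumes "a \<in> Adj" shows "app (star a) = adj ip (app a)"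
proof -
  obtain b where "adj ip (app a) = app b"
    using adjointable_clin adjointable_adj assms by (auto simp: Adj_iff)
  then show ?thesis by (simp add: star_def app_inverse)
qed

lemma ip_star: "a \<in> Adj \<Longrightarrow> ip (app a x) y = ip x (app (star a) y)"
  using ip_adj by (simp add: Adj_iff app_star)

lemma ip_star': "a \<in> Adj \<Longrightarrow> ip (app (star a) x) y = ip x (app a y)"
  using ip_adj' by (simp add: Adj_iff app_star)

lemma star_Adj: "a \<in> Adj \<Longrightarrow> star a \<in> Adj"
  and star_star: "a \<in> Adj \<Longrightarrow> star (star a) = a"
  using adjointI[of "star a" a] by (simp_all add: ip_star')

lemma one_Adj: "1 \<in> Adj"
  by (rule adjointI[of _ 1]) (simp add: app_simps)

lemma add_Adj: "\<lbrakk>a \<in> Adj; b \<in> Adj\<rbrakk> \<Longrightarrow> a + b \<in> Adj"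
  and star_add: "\<lbrakk>a \<in> Adj; b \<in> Adj\<rbrakk> \<Longrightarrow> star (a + b) = star a + star b"
  using adjointI[of "a + b" "star a + star b"]
  by (simp_all add: app_apply ip_add_left ip_add_right ip_star)

lemma diff_Adj: "\<lbrakk>a \<in> Adj; b \<in> Adj\<rbrakk> \<Longrightarrow> a - b \<in> Adj"
  and star_diff: "\<lbrakk>a \<in> Adj; b \<in> Adj\<rbrakk> \<Longrightarrow> star (a - b) = star a - star b"
  using adjointI[of "a - b" "star a - star b"]
  by (simp_all add: app_apply ip_diff_left ip_diff_right ip_star)

lemma mult_Adj: "\<lbrakk>a \<in> Adj; b \<in> Adj\<rbrakk> \<Longrightarrow> a * b \<in> Adj"
  and star_mult: "\<lbrakk>a \<in> Adj; b \<in> Adj\<rbrakk> \<Longrightarrow> star (a * b) = star b * star a"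
  using adjointI[of "a * b" "star b * star a"] by (simp_all add: app_apply ip_star)

lemma scaleR_Adj: "a \<in> Adj \<Longrightarrow> r *\<^sub>R a \<in> Adj"
  and star_scaleR: "a \<in> Adj \<Longrightarrow> star (r *\<^sub>R a) = r *\<^sub>R star a"
  using adjointI[of "r *\<^sub>R a" "r *\<^sub>R star a"]
  by (simp_all add: app_apply ip_scaleR_left ip_scaleR_right ip_star)

lemma imag_clin_Adj: "imag_clin \<in> Adj"
  and star_imag_clin: "star imag_clin = - imag_clin"
proof -
  have "ip (app imag_clin x) y = ip x (app (- imag_clin) y)" for x y
    using ip_cscale_right[of x "- \<i>" y] by (simp add: imag_clin.rep_eq app_apply ip_cscale_left)
  then show "imag_clin \<in> Adj" "star imag_clin = - imag_clin" by (rule adjointI)+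
qed

lemma op_norm_bound: assumes "a \<in> Adj" shows "hnorm (app a x) \<le> op_norm a * hnorm x"
proof (cases "x = 0")
  case False
  obtain K where "0 \<le> K" "\<And>x. hnorm (app a x) \<le> K * hnorm x"
    using adjointable_bounded assms unfolding Adj_iff by blast
  then have "hnorm (app a x) / hnorm x \<le> op_norm a"
    unfolding op_norm_def using hnorm_pos[OF False] by (intro cInf_greatest) (auto simp: pos_divide_le_eq)
  then show ?thesis using hnorm_pos[OF False] by (simp add: pos_divide_le_eq)
qed simp

lemma op_norm_le: "\<lbrakk>0 \<le> K; \<And>x. hnorm (app a x) \<le> K * hnorm x\<rbrakk> \<Longrightarrow> op_norm a \<le> K"
  unfolding op_norm_def by (intro cInf_lower bdd_belowI[of _ 0]) auto

lemma op_norm_nonneg: assumes "a \<in> Adj" shows "0 \<le> op_norm a"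
proof -
  obtain K where "0 \<le> K" "\<And>x. hnorm (app a x) \<le> K * hnorm x"
    using adjointable_bounded assms unfolding Adj_iff by blast
  then show ?thesis unfolding op_norm_def by (intro cInf_greatest) auto
qed

lemma op_norm_eq_0: assumes "a \<in> Adj" "op_norm a = 0" shows "a = 0"
proof -
  have "app a x = 0" for x using op_norm_bound[OF assms(1), of x] assms(2) hnorm_pos[of "app a x"] by force
  then show ?thesis by (simp add: app_inject[symmetric] zero_clin.rep_eq fun_eq_iff)
qed

lemma op_norm_add: assumes "a \<in> Adj" "b \<in> Adj" shows "op_norm (a + b) \<le> op_norm a + op_norm b"
proof (rule op_norm_le)
  fix x
  show "hnorm (app (a + b) x) \<le> (op_norm a + op_norm b) * hnorm x"
    using hnorm_triangle[of "app a x" "app b x"] op_norm_bound[OF assms(1), of x] op_norm_bound[OF assms(2), of x]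
    by (simp add: app_apply distrib_right)
qed (simp add: op_norm_nonneg assms)

lemma op_norm_mult: assumes "a \<in> Adj" "b \<in> Adj" shows "op_norm (a * b) \<le> op_norm a * op_norm b"
proof (rule op_norm_le)
  fix x
  have "hnorm (app a (app b x)) \<le> op_norm a * hnorm (app b x)" by (rule op_norm_bound[OF assms(1)])
  also have "\<dots> \<le> op_norm a * (op_norm b * hnorm x)"
    by (intro mult_left_mono op_norm_bound op_norm_nonneg assms)
  finally show "hnorm (app (a * b) x) \<le> op_norm a * op_norm b * hnorm x" by (simp add: app_simps mult.assoc)
qed (simp add: assms op_norm_nonneg)

lemma op_norm_scaleR: assumes a: "a \<in> Adj" shows "op_norm (r *\<^sub>R a) = \<bar>r\<bar> * op_norm a"
proof -
  have scale_le: "op_norm (t *\<^sub>R b) \<le> \<bar>t\<bar> * op_norm b" if "b \<in> Adj" for t b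
  proof (rule op_norm_le)
    fix x
    show "hnorm (app (t *\<^sub>R b) x) \<le> \<bar>t\<bar> * op_norm b * hnorm x"
      using mult_left_mono[OF op_norm_bound[OF that], of "\<bar>t\<bar>" x]
      by (simp add: app_apply hnorm_scaleR mult.assoc)
  qed (simp add: op_norm_nonneg that)
  have "\<bar>r\<bar> * op_norm a \<le> op_norm (r *\<^sub>R a)"
  proof (cases "r = 0")
    case False
    then have "op_norm a \<le> \<bar>1 / r\<bar> * op_norm (r *\<^sub>R a)"
      using scale_le[OF scaleR_Adj[OF a], of "1 / r" r] by simp
    then show ?thesis using False by (simp add: field_simps)
  qed (use op_norm_nonneg[OF scaleR_Adj[OF a, of r]] in simp)
  with scale_le[OF a] show ?thesis by (rule antisym)
qed

lemma op_norm_star: assumes "a \<in> Adj" shows "op_norm (star a) = op_norm a"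
proof -
  have op_norm_star_le: "op_norm (star b) \<le> op_norm b" if b: "b \<in> Adj" for b
  proof (rule op_norm_le[OF op_norm_nonneg[OF b]], rule hnorm_le_if_ip_le)
    fix x y
    have "norm (ip (app (star b) x) y) \<le> hnorm x * hnorm (app b y)"
      using cauchy_schwarz by (simp add: ip_star'[OF b])
    also have "\<dots> \<le> hnorm x * (op_norm b * hnorm y)" by (intro mult_left_mono op_norm_bound b) simp
    finally show "norm (ip (app (star b) x) y) \<le> op_norm b * hnorm x * hnorm y" by (simp add: mult_ac)
  qed (simp add: op_norm_nonneg b)
  show ?thesis using op_norm_star_le[of a] op_norm_star_le[of "star a"] assms by (simp add: star_Adj star_star)
qed

lemma op_norm_square_le: assumes a: "a \<in> Adj" shows "(op_norm a)\<^sup>2 \<le> op_norm (star a * a)"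
proof -
  have square_Adj: "star a * a \<in> Adj" by (intro mult_Adj star_Adj a)
  have "op_norm a \<le> sqrt (op_norm (star a * a))"
  proof (rule op_norm_le)
    fix x
    have "(hnorm (app a x))\<^sup>2 = norm (ip x (app (star a * a) x))"
      by (simp add: hnorm_square ip_star[OF a] app_simps)
    also have "\<dots> \<le> hnorm x * hnorm (app (star a * a) x)" by (rule cauchy_schwarz)
    also have "\<dots> \<le> hnorm x * (op_norm (star a * a) * hnorm x)"
      by (intro mult_left_mono op_norm_bound square_Adj) simp
    finally have "(hnorm (app a x))\<^sup>2 \<le> op_norm (star a * a) * (hnorm x)\<^sup>2"
      by (simp add: power2_eq_square mult_ac)
    then have "hnorm (app a x) \<le> sqrt (op_norm (star a * a) * (hnorm x)\<^sup>2)" by (rule real_le_rsqrt)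
    then show "hnorm (app a x) \<le> sqrt (op_norm (star a * a)) * hnorm x" by (simp add: real_sqrt_mult)
  qed (simp add: op_norm_nonneg square_Adj)
  then show ?thesis using op_norm_nonneg[OF a] op_norm_nonneg[OF square_Adj]
    by (metis power_mono real_sqrt_pow2)
qed

subsection \<open>Completeness\<close>

lemma op_norm_Cauchy_pointwise_limit:
  assumes f: "\<And>n::nat. f n \<in> Adj" and cauchy: "\<forall>e>0. \<exists>M. \<forall>m\<ge>M. \<forall>n\<ge>M. op_norm (f m - f n) < e"
  obtains T where "\<And>x. (\<lambda>n. hnorm (app (f n) x - T x)) \<longlonglongrightarrow> 0"
proof -
  have "\<exists>y. (\<lambda>n. hnorm (app (f n) x - y)) \<longlonglongrightarrow> 0" for x
  proof (rule hmod_complete, intro allI impI)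
    fix e :: real assume "0 < e"
    have denominator_pos: "0 < hnorm x + 1" by (simp add: add_nonneg_pos)
    obtain M where M: "\<And>m n. \<lbrakk>m \<ge> M; n \<ge> M\<rbrakk> \<Longrightarrow> op_norm (f m - f n) < e / (hnorm x + 1)"
      using cauchy \<open>0 < e\<close> denominator_pos divide_pos_pos by meson
    have "hnorm (app (f m) x - app (f n) x) < e" if "m \<ge> M" "n \<ge> M" for m n
    proof -
      have "hnorm (app (f m) x - app (f n) x) \<le> op_norm (f m - f n) * hnorm x"
        using op_norm_bound[OF diff_Adj[OF f f], of m n x] by (simp add: app_apply)
      also have "\<dots> \<le> e / (hnorm x + 1) * hnorm x" using M[OF that] by (intro mult_right_mono) auto
      also have "\<dots> < e" using \<open>0 < e\<close> denominator_pos by (simp add: pos_divide_less_eq)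
      finally show ?thesis .
    qed
    then show "\<exists>M. \<forall>m\<ge>M. \<forall>n\<ge>M. hnorm (app (f m) x - app (f n) x) < e" by blast
  qed
  then show thesis using that by metis
qed

lemma op_norm_diff_le_pointwise_limit:
  assumes f: "\<And>n::nat. f n \<in> Adj" and lim: "\<And>x. (\<lambda>n. hnorm (app (f n) x - app a x)) \<longlonglongrightarrow> 0"
    and bound: "0 \<le> e" "\<And>m. m \<ge> M \<Longrightarrow> op_norm (f n - f m) \<le> e"
  shows "op_norm (f n - a) \<le> e"
proof (rule op_norm_le[OF bound(1)])
  fix x
  have "hnorm (app (f n) x - app a x) \<le> e * hnorm x + hnorm (app (f m) x - app a x)" if "m \<ge> M" for m
  proof -
    have "hnorm (app (f n) x - app (f m) x) \<le> op_norm (f n - f m) * hnorm x"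
      using op_norm_bound[OF diff_Adj[OF f f], of n m x] by (simp add: app_apply)
    also have "\<dots> \<le> e * hnorm x" using bound(2)[OF that] by (intro mult_right_mono) auto
    finally show ?thesis
      using hnorm_triangle_diff[of "app (f n) x" "app a x" "app (f m) x"] by linarith
  qed
  moreover have "(\<lambda>m. e * hnorm x + hnorm (app (f m) x - app a x)) \<longlonglongrightarrow> e * hnorm x + 0"
    by (intro tendsto_intros lim)
  ultimately have "hnorm (app (f n) x - app a x) \<le> e * hnorm x + 0"
    by (intro LIMSEQ_le_const) auto
  then show "hnorm (app (f n - a) x) \<le> e * hnorm x" by (simp add: app_apply)
qed

lemma Adj_complete:
  assumes f: "\<And>n::nat. f n \<in> Adj"
    and cauchy: "\<forall>e>0. \<exists>M. \<forall>m\<ge>M. \<forall>n\<ge>M. op_norm (f m - f n) < e"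
  shows "\<exists>a\<in>Adj. (\<lambda>n. op_norm (f n - a)) \<longlonglongrightarrow> 0"
proof -
  obtain T where T: "\<And>x. (\<lambda>n. hnorm (app (f n) x - T x)) \<longlonglongrightarrow> 0"
    using op_norm_Cauchy_pointwise_limit[OF f cauchy] by blast
  have "op_norm (star (f m) - star (f n)) = op_norm (f m - f n)" for m n
    using op_norm_star[OF diff_Adj[OF f f]] by (simp add: star_diff f)
  then have "\<forall>e>0. \<exists>M. \<forall>m\<ge>M. \<forall>n\<ge>M. op_norm (star (f m) - star (f n)) < e" using cauchy by simp
  then obtain S where S: "\<And>x. (\<lambda>n. hnorm (app (star (f n)) x - S x)) \<longlonglongrightarrow> 0"
    using op_norm_Cauchy_pointwise_limit[of "\<lambda>n. star (f n)", OF star_Adj[OF f]] by blast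
  have "ip (T x) y = ip x (S y)" for x y
    using LIMSEQ_unique[OF ip_tendsto_left[OF T[of x], of y]] ip_tendsto_right[OF S[of y], of x]
      ip_star[OF f] by simp
  then have "adjointable ip T" unfolding adjointable_def by blast
  then obtain a where a: "a \<in> Adj" "T = app a" by (rule app_adjointable)
  have "(\<lambda>n. op_norm (f n - a)) \<longlonglongrightarrow> 0"
  proof (rule LIMSEQ_I)
    fix e :: real assume e_pos: "0 < e"
    then obtain M where M: "\<And>m n. \<lbrakk>m \<ge> M; n \<ge> M\<rbrakk> \<Longrightarrow> op_norm (f m - f n) < e / 2"
      using cauchy half_gt_zero by meson
    have "norm (op_norm (f n - a) - 0) < e" if "n \<ge> M" for n
    proof -
      have "op_norm (f n - a) \<le> e / 2"
      proof (rule op_norm_diff_le_pointwise_limit[OF f T[unfolded a(2)]])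
        show "op_norm (f n - f m) \<le> e / 2" if "m \<ge> M" for m
          using M[OF \<open>n \<ge> M\<close> that] by (rule less_imp_le)
      qed (use e_pos in simp)
      then show ?thesis using e_pos op_norm_nonneg[OF diff_Adj[OF f a(1)]] by (simp add: abs_of_nonneg)
    qed
    then show "\<exists>M. \<forall>n\<ge>M. norm (op_norm (f n - a) - 0) < e" by blast
  qed
  with a(1) show ?thesis by blast
qed

sublocale L: unital_cstar Adj star op_norm imag_clin
proof
  show "x * imag_clin = imag_clin * x" for x :: "'m clin"
    by (simp add: app_inject[symmetric] app_apply imag_clin.rep_eq fun_eq_iff app.scale)
  show "imag_clin * imag_clin = (- 1 :: 'm clin)"
    by (simp add: app_inject[symmetric] app_apply imag_clin.rep_eq fun_eq_iff)
qed (fact one_Adj add_Adj mult_Adj scaleR_Adj star_Adj star_star star_add star_mult star_scaleR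
    op_norm_eq_0 op_norm_add op_norm_scaleR op_norm_mult op_norm_square_le Adj_complete imag_clin_Adj star_imag_clin)+

subsection \<open>Operator constructions\<close>

lemma op_pos_iff: "op_pos ip T \<longleftrightarrow> (\<exists>a. L.pos a \<and> T = app a)"
proof
  assume "op_pos ip T"
  then obtain R where R: "adjointable ip R" "T = adj ip R \<circ> R" by (auto simp: op_pos_def)
  obtain r where r: "r \<in> Adj" "R = app r" using R(1) by (rule app_adjointable)
  have "T = app (star r * r)" using R(2) r by (simp add: app_simps app_star)
  with L.pos_st_mult[OF r(1)] show "\<exists>a. L.pos a \<and> T = app a" by blast
next
  assume "\<exists>a. L.pos a \<and> T = app a"
  then obtain a where a: "L.pos a" "T = app a" by blast
  obtain h where h: "h \<in> Adj" "star h = h" "a = h * h" using a(1) by (rule L.posE)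
  have "adj ip (app h) = app h" using app_star[OF h(1), unfolded h(2)] by (rule sym)
  then have "T = adj ip (app h) \<circ> app h" using a(2) h(3) by (simp add: app_simps)
  then show "op_pos ip T" using h(1) by (auto simp: op_pos_def Adj_iff)
qed

lemma op_abs_app:
  assumes a: "a \<in> Adj" and s: "L.is_modulus s a"
  shows "op_abs ip (app a) = app s"
  unfolding op_abs_def
proof (rule the_equality)
  show "op_pos ip (app s) \<and> app s \<circ> app s = adj ip (app a) \<circ> app a"
    using s a op_pos_iff by (auto simp: L.is_modulus_def simp flip: app_star times_clin.rep_eq)
next
  fix S assume "op_pos ip S \<and> S \<circ> S = adj ip (app a) \<circ> app a"
  then obtain b where "S = app b" "L.is_modulus b a"
    using a by (auto simp: op_pos_iff L.is_modulus_def app_inject simp flip: app_star times_clin.rep_eq)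
  then show "S = app s" using L.is_modulus_unique s by blast
qed

lemma mp_inv_app:
  assumes a: "a \<in> Adj" and x: "L.is_mp_inverse a x"
  shows "mp_inv ip (app a) = app x"
  unfolding mp_inv_def
proof (rule the_equality)
  have mp_iff: "adjointable ip (app y) \<and> app a \<circ> app y \<circ> app a = app a \<and> app y \<circ> app a \<circ> app y = app y
      \<and> adj ip (app a \<circ> app y) = app a \<circ> app y \<and> adj ip (app y \<circ> app a) = app y \<circ> app a
    \<longleftrightarrow> L.is_mp_inverse a y" for y
  proof (cases "y \<in> Adj")
    case True
    then show ?thesis using a
      by (simp add: L.is_mp_inverse_def app_inject flip: times_clin.rep_eq app_star) (simp add: Adj_iff)
  qed (simp add: L.is_mp_inverse_def Adj_iff)
  show "adjointable ip (app x) \<and> app a \<circ> app x \<circ> app a = app a \<and> app x \<circ> app a \<circ> app x = app x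
      \<and> adj ip (app a \<circ> app x) = app a \<circ> app x \<and> adj ip (app x \<circ> app a) = app x \<circ> app a"
    unfolding mp_iff by (rule x)
  fix X assume X: "adjointable ip X \<and> app a \<circ> X \<circ> app a = app a \<and> X \<circ> app a \<circ> X = X
      \<and> adj ip (app a \<circ> X) = app a \<circ> X \<and> adj ip (X \<circ> app a) = X \<circ> app a"
  then obtain y where "X = app y" using app_adjointable by blast
  with X mp_iff[of y] show "X = app x" using L.is_mp_inverse_unique[OF a _ x] by simp
qed

lemma op_inv_app:
  assumes "L.is_inverse a x"
  shows "op_inv ip (app a) = app x"
  unfolding op_inv_def
proof (rule the_equality)
  show inverse: "adjointable ip (app x) \<and> app x \<circ> app a = id \<and> app a \<circ> app x = id"
    using assms by (simp add: L.is_inverse_def Adj_iff flip: times_clin.rep_eq one_clin.rep_eq)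
  fix X assume "adjointable ip X \<and> X \<circ> app a = id \<and> app a \<circ> X = id"
  with inverse show "X = app x" by (metis comp_assoc comp_id id_comp)
qed

lemma range_app_subset_iff:
  assumes "b * b = b"
  shows "range (app c) \<subseteq> range (app b) \<longleftrightarrow> b * c = c"
proof
  assume "range (app c) \<subseteq> range (app b)"
  then have "\<exists>y. app c x = app b y" for x by blast
  moreover have "app b (app b y) = app b y" for y using assms by (metis times_clin.rep_eq comp_apply)
  ultimately have "app b (app c x) = app c x" for x by metis
  then show "b * c = c" by (simp add: app_inject[symmetric] app_apply fun_eq_iff)
next
  assume "b * c = c"
  then have "app c x = app b (app c x)" for x by (metis times_clin.rep_eq comp_apply)
  then show "range (app c) \<subseteq> range (app b)" by blast
qed

lemma range_proj_app:
  assumes q: "q \<in> Adj" and p: "L.is_range_projection p q"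
  shows "range_proj ip (app q) = app p"
  unfolding range_proj_def
proof (rule the_equality)
  have p_sa: "p \<in> Adj" "star p = p" "p * q = q" "q * p = p"
    using p by (auto simp: L.is_range_projection_def)
  have p_idem: "p * p = p" using p by (rule L.is_range_projection_idem)
  have q_idem: "q * q = q" using p_sa by (metis mult.assoc)
  have range_pq: "range (app p) = range (app q)"
    using range_app_subset_iff[OF p_idem] range_app_subset_iff[OF q_idem] p_sa by blast
  then show "adjointable ip (app p) \<and> app p \<circ> app p = app p \<and> adj ip (app p) = app p
      \<and> range (app p) = range (app q)"
    using p_sa p_idem by (simp flip: times_clin.rep_eq app_star) (simp add: Adj_iff)
  fix P assume P: "adjointable ip P \<and> P \<circ> P = P \<and> adj ip P = P \<and> range P = range (app q)"
  then obtain r where r: "r \<in> Adj" "P = app r" using app_adjointable by blast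
  have r_idem_sa: "r * r = r" "star r = r"
    using P r by (simp_all add: app_inject flip: times_clin.rep_eq app_star)
  have "r * p = p" "p * r = r"
    using range_app_subset_iff[OF r_idem_sa(1), of p] range_app_subset_iff[OF p_idem, of r] P r range_pq by auto
  then have "r = p" using star_mult[of r p] r p_sa r_idem_sa by simp
  then show "P = app p" using r by simp
qed

lemma matched_proj_app:
  assumes a: "a \<in> Adj" and s: "L.is_modulus s (star a)" and x: "L.is_mp_inverse s x"
    and e: "L.is_inverse (s + 1) e"
  shows "matched_proj ip (app a) = app (L.matched s x e a)"
proof -
  have s_Adj: "s \<in> Adj" using s by (simp add: L.is_modulus_def)
  have "op_abs ip (adj ip (app a)) = app s"
    using op_abs_app[OF star_Adj s] a by (simp add: app_star)
  moreover have "op_inv ip (op_add (app s) id) = app e"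
    using op_inv_app[OF e] by (simp add: app_simps)
  ultimately show ?thesis
    using a mp_inv_app[OF s_Adj x]
    by (simp add: matched_proj_def L.matched_def Let_def app_simps app_star comp_assoc)
qed

end

section \<open>The Cauchy--Schwarz inequality\<close>

text \<open>A C*-algebra is a complete inner product module over itself, for which the Cauchy--Schwarz
  inequality is just submultiplicativity of the norm.  Left multiplication then embeds it into a
  unital C*-algebra, from which it inherits the order properties needed for general modules.\<close>

lemma norm_cstar [simp]: "norm (cstar x) = norm (x::'a::cstar_algebra)"
proof -
  have norm_le: "norm y \<le> norm (cstar y)" for y :: 'a
    by (rule le_if_square_le_mult)
      (use cstar_identity[of y] norm_mult_ineq[of "cstar y" y] in simp_all)
  show ?thesis using norm_le[of x] norm_le[of "cstar x"] by (simp add: cstar_cstar)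
qed

lemma hmod_norm_self [simp]: "hmod_norm (\<lambda>x y. cstar x * y) x = norm (x::'a::cstar_algebra)"
  by (simp add: hmod_norm_def cstar_identity)

interpretation self: complete_inner "\<lambda>x y :: 'a::cstar_algebra. cstar x * y"
proof
  fix x y z :: 'a and c
  show "cstar x * (y + z) = cstar x * y + cstar x * z" by (rule distrib_left)
  show "cstar x * cscale c y = cscale c (cstar x * y)" by (rule cscale_mult_right[symmetric])
  show "cstar y * x = cstar (cstar x * y)" by (simp add: cstar_mult cstar_cstar)
  show "x = 0" if "cstar x * x = 0" using cstar_identity[of x] that by simp
  show "norm (cstar x * y) \<le> hmod_norm (\<lambda>x y. cstar x * y) x * hmod_norm (\<lambda>x y. cstar x * y) y"
    using norm_mult_ineq[of "cstar x" y] by simp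
  fix f :: "nat \<Rightarrow> 'a"
  assume "\<forall>e>0. \<exists>M. \<forall>m\<ge>M. \<forall>n\<ge>M. hmod_norm (\<lambda>x y. cstar x * y) (f m - f n) < e"
  then have "Cauchy f" by (simp add: Cauchy_def dist_norm)
  then obtain l where "f \<longlonglongrightarrow> l" using Cauchy_convergent convergent_def by blast
  then show "\<exists>x. (\<lambda>n. hmod_norm (\<lambda>x y. cstar x * y) (f n - x)) \<longlonglongrightarrow> 0"
    by (auto intro!: exI[of _ l] tendsto_norm_zero simp: LIM_zero_iff)
qed

lift_definition lmul :: "'a::cstar_algebra \<Rightarrow> 'a clin" is "(*)"
  by (simp add: Vector_Spaces.linear_iff cscale.vector_space_axioms distrib_left cscale_mult_right)

lemma lmul_add: "lmul (a + b) = lmul a + lmul b"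
  and lmul_diff: "lmul (a - b) = lmul a - lmul b"
  and lmul_mult: "lmul (a * b) = lmul a * lmul b"
  and lmul_scaleR: "lmul (r *\<^sub>R a) = r *\<^sub>R lmul a"
  by (simp_all add: app_inject[symmetric] lmul.rep_eq app_apply fun_eq_iff algebra_simps)

lemma lmul_Adj [simp]: "lmul a \<in> self.Adj"
  and star_lmul [simp]: "self.star (lmul a) = lmul (cstar a)"
  by (rule self.adjointI[of _ "lmul (cstar a)"], simp add: lmul.rep_eq cstar_mult mult.assoc)+

lemma op_norm_lmul [simp]: "self.op_norm (lmul a) = norm a"
proof (rule antisym)
  show "self.op_norm (lmul a) \<le> norm a"
    by (rule self.op_norm_le) (auto simp: lmul.rep_eq norm_mult_ineq)
  have "(norm a)\<^sup>2 \<le> self.op_norm (lmul a) * norm a"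
    using self.op_norm_bound[OF lmul_Adj, of a "cstar a"] cstar_identity[of "cstar a"]
    by (simp add: lmul.rep_eq cstar_cstar)
  then show "norm a \<le> self.op_norm (lmul a)"
    by (rule le_if_square_le_mult) (simp add: self.op_norm_nonneg)
qed

definition nonneg :: "'a::cstar_algebra \<Rightarrow> bool" where
  "nonneg a \<longleftrightarrow> self.L.pos (lmul a)"

lemma nonneg_if_cpos: "cpos a \<Longrightarrow> nonneg a"
  using self.L.pos_st_mult[OF lmul_Adj] by (auto simp: nonneg_def cpos_def lmul_mult)

lemma nonneg_cstar_mult: "nonneg (cstar a * a)"
  by (rule nonneg_if_cpos) (auto simp: cpos_def)

lemma nonneg_add: "\<lbrakk>nonneg a; nonneg b\<rbrakk> \<Longrightarrow> nonneg (a + b)"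
  by (simp add: nonneg_def lmul_add self.L.pos_add)

lemma nonneg_scaleR: "\<lbrakk>nonneg a; 0 \<le> r\<rbrakk> \<Longrightarrow> nonneg (r *\<^sub>R a)"
  by (simp add: nonneg_def lmul_scaleR self.L.pos_scaleR)

lemma norm_mono_nonneg: "\<lbrakk>nonneg a; nonneg (b - a)\<rbrakk> \<Longrightarrow> norm a \<le> norm b"
  using self.L.pos_nrm_mono[of "lmul a" "lmul (b - a)"] by (simp add: nonneg_def flip: lmul_add)

lemma nonneg_norm_minus_conj:
  assumes "cstar u = u"
  shows "nonneg (norm u *\<^sub>R (cstar a * a) - cstar a * u * a)"
proof (cases "u = 0")
  case False
  have "self.L.pos (norm u *\<^sub>R 1 - lmul u)"
    using False assms by (intro self.L.pos_scalar_minus) auto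
  then have "self.L.pos (self.star (lmul a) * (norm u *\<^sub>R 1 - lmul u) * lmul a)"
    by (rule self.L.pos_conj) simp
  moreover have "self.star (lmul a) * (norm u *\<^sub>R 1 - lmul u) * lmul a
      = lmul (norm u *\<^sub>R (cstar a * a) - cstar a * u * a)"
    by (simp add: lmul_diff lmul_mult lmul_scaleR left_diff_distrib right_diff_distrib)
  ultimately show ?thesis by (simp add: nonneg_def)
qed (simp add: nonneg_scaleR[OF nonneg_cstar_mult, of 0, simplified])

lemma hilbert_module_cauchy_schwarz:
  assumes "sesquilinear_definite ip"
    and act: "\<And>x y a. ip x (act y a) = ip x y * a" and pos: "\<And>x. cpos (ip x x)"
  shows "norm (ip x y) \<le> hmod_norm ip x * hmod_norm ip y"
proof (cases "x = 0")
  case True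
  interpret sesquilinear_definite ip by fact
  show ?thesis using True ip_scaleR_left[of 0 x y] by simp
next
  case False
  interpret sesquilinear_definite ip by fact
  define n where "n = norm (ip x x)"
  have n_pos: "0 < n" using False ip_definite[of x] by (auto simp: n_def)
  define a where "a = ip x y"
  define d where "d = cstar a * ip x x * a"
  define z where "z = act x a - n *\<^sub>R y"
  have act_left: "ip (act x a) w = cstar a * ip x w" for w
    by (metis act ip_sym cstar_mult cstar_cstar)
  have ip_y_x: "ip y x = cstar a" by (metis a_def ip_sym)
  have "ip z z = d - n *\<^sub>R (cstar a * a) - n *\<^sub>R (cstar a * a) + (n * n) *\<^sub>R ip y y"
    by (simp add: z_def ip_diff_left ip_diff_right ip_scaleR_left ip_scaleR_right act act_left ip_y_x
        scaleR_diff_right left_diff_distrib d_def mult.assoc flip: a_def)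
  moreover have "nonneg (ip z z + (n *\<^sub>R (cstar a * a) - d))"
    unfolding n_def d_def
    by (intro nonneg_add nonneg_if_cpos pos nonneg_norm_minus_conj ip_sym[symmetric])
  ultimately have "nonneg ((n * n) *\<^sub>R ip y y - n *\<^sub>R (cstar a * a))" by simp
  then have "norm (n *\<^sub>R (cstar a * a)) \<le> norm ((n * n) *\<^sub>R ip y y)"
    using n_pos by (intro norm_mono_nonneg nonneg_scaleR nonneg_cstar_mult) auto
  then have "(norm a)\<^sup>2 \<le> n * norm (ip y y)" using n_pos by (simp add: cstar_identity)
  then have "norm a \<le> sqrt (n * norm (ip y y))" by (rule real_le_rsqrt)
  then show ?thesis by (simp add: a_def n_def hmod_norm_def real_sqrt_mult)
qed

lemma hilbert_cstar_moduleD: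
  assumes "hilbert_cstar_module ip act"
  shows "\<forall>x y z. ip x (y + z) = ip x y + ip x z"
    and "\<forall>c x y. ip x (cscale c y) = cscale c (ip x y)"
    and "\<forall>x y. ip y x = cstar (ip x y)"
    and "\<forall>x. ip x x = 0 \<longrightarrow> x = 0"
    and "\<forall>x y a. ip x (act y a) = ip x y * a"
    and "\<forall>x. cpos (ip x x)"
    and "\<forall>f :: nat \<Rightarrow> 'm::complex_vs. (\<forall>e>0. \<exists>M. \<forall>m\<ge>M. \<forall>n\<ge>M. hmod_norm ip (f m - f n) < e) \<longrightarrow>
      (\<exists>x. (\<lambda>n. hmod_norm ip (f n - x)) \<longlonglongrightarrow> 0)"
  using assms unfolding hilbert_cstar_module_def by - (elim conjE, assumption)+

lemma hilbert_cstar_module_complete_inner: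
  assumes "hilbert_cstar_module ip act"
  shows "complete_inner ip"
proof -
  note module = hilbert_cstar_moduleD[OF assms]
  have sesquilinear: "sesquilinear_definite ip"
    by (rule sesquilinear_definite.intro) (fact module(1-4)[rule_format])+
  have "norm (ip x y) \<le> hmod_norm ip x * hmod_norm ip y" for x y
    using sesquilinear module(5,6)[rule_format] by (rule hilbert_module_cauchy_schwarz)
  then show ?thesis
    using module(7)[THEN spec, THEN mp]
    by (intro complete_inner.intro complete_inner_axioms.intro sesquilinear)
qed

theorem theorem5p3:
  fixes ip :: "'m::complex_vs \<Rightarrow> 'm \<Rightarrow> 'a::cstar_algebra"
    and act :: "'m \<Rightarrow> 'a \<Rightarrow> 'm"
    and Q :: "'m \<Rightarrow> 'm"
  assumes "hilbert_cstar_module ip act"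
    and "adjointable ip Q"
    and "Q \<circ> Q = Q"
  shows "supp_proj ip Q =
           op_add (op_add (matched_proj ip Q)
                     (op_diff id (adj ip Q) \<circ> mp_inv ip (op_abs ip (adj ip Q))))
                  (mp_inv ip (op_abs ip (adj ip Q)) \<circ> op_diff id Q)"
proof -
  interpret complete_inner ip using assms(1) by (rule hilbert_cstar_module_complete_inner)
  obtain q where q: "q \<in> Adj" "Q = app q" using assms(2) by (rule app_adjointable)
  have "q * q = q" using assms(3) q by (simp add: app_inject flip: times_clin.rep_eq)
  then obtain p where p: "L.is_range_projection p q" using L.idempotent_range_projection q by blast
  obtain s x where s: "L.is_modulus s (star q)" and x: "L.is_mp_inverse s x" "s * x = p" "x * s = p"
    using L.idempotent_modulus[OF q(1) p] by blast
  obtain e where e: "L.is_inverse (s + 1) e"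
    using L.pos_one_plus_inverse s(1) by (metis L.is_modulus_def add.commute)
  have p_Adj: "p \<in> Adj" and s_Adj: "s \<in> Adj"
    using p s by (auto simp: L.is_range_projection_def L.is_modulus_def)
  have "supp_proj ip Q = matched_proj ip (app (2 *\<^sub>R p - q))"
    using range_proj_app[OF q(1) p] by (simp add: supp_proj_def q(2) app_simps)
  also have "\<dots> = app (L.matched s x e (2 *\<^sub>R p - q))"
    using p_Adj q(1) L.is_modulus_reflect[OF q(1) p s] x(1) e by (intro matched_proj_app) auto
  also have "\<dots> = app (L.matched s x e q + (1 - star q) * x + x * (1 - q))"
    using L.matched_reflect[OF q(1) p s_Adj x e] by simp
  finally show ?thesis
    using q s x e s_Adj op_abs_app[of "star q" s]
    by (simp add: matched_proj_app mp_inv_app star_Adj app_simps app_star)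
qed

end
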